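(* Let $\mathcal{C}$ be a self-orthogonal subcategory of $\mathfrak{C}$, let $\mathcal{T}$ be a subcategory of $\mathfrak{C}$, and let $n\geq 1$ be an integer. Assume that $\mathcal{C}\subseteq \mathrm{Copres}^{n}\big(\mathrm{Pres}^{n}_{{}_{\mathcal{C}}\mathscr{X}}(\mathcal{T})\big)$ and that $\mathcal{T}$ is strongly contravariantly finite in $\mathfrak{C}$. Then $(\mathcal{C},\mathcal{T})$ is an $n$-tilting pair if and only if $\mathrm{Pres}^{n}_{{}_{\mathcal{C}}\mathscr{X}}(\mathcal{T})=\mathcal{T}^{\bot}\cap{}_{\mathcal{C}}\mathscr{X}$.
   Context: Standing assumptions: $(\mathfrak{C},\mathbb{E},\mathfrak{s})$ is a Krull-Schmidt extriangulated category (in the sense of Nakaoka-Palu) with enough projectives and enough injectives, satisfying the WIC condition: if $gf$ is an inflation then so is $f$; if $gf$ is a deflation then so is $g$. "Subcategory" means full additive subcategory closed under isomorphisms and direct summands. $\mathbb{E}$-triangles: $A\to B\to C\dashrightarrow$ is an $\mathbb{E}$-triangle if it realizes some element of $\mathbb{E}(C,A)$; then $A\to B$ is an inflation with cone $C$, and $B\to C$ a deflation with cocone $A$. Higher extensions are $\mathbb{E}^{i+1}(X,Y)\cong\mathbb{E}(X,\Sigma^{i}Y)\cong\mathbb{E}(\Omega^{i}X,Y)$ for $i\ge 0$, where $\Omega$, $\Sigma$ denote syzygy and cosyzygy. An $\mathbb{E}$-triangle sequence is a sequence of morphisms obtained by splicing $\mathbb{E}$-triangles $K_{i+1}\to W_i\to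 K_i\dashrightarrow$ (a finite sequence begins with the cocone term of the first spliced $\mathbb{E}$-triangle and ends with the cone term of the last). For a subcategory $\omega$: $\omega^{\bot}=\{Y\mid \mathbb{E}^{i}(X,Y)=0\ \forall i\ge1,\ \forall X\in\omega\}$; $\omega$ is self-orthogonal if $\omega\subseteq\omega^{\bot}$. $\hat{\omega}_n$ is the class of $A$ admitting an $\mathbb{E}$-triangle sequence $W_n\to\cdots\to W_0\to A$ with all $W_i\in\omega$; $\check{\omega}_n$ is the class of $A$ admitting an $\mathbb{E}$-triangle sequence $A\to W^0\to\cdots\to W^n$ with all $W^i\in\omega$ (for $n=0$ both are $\omega$); $\hat\omega=\bigcup_n\hat\omega_n$, $\check\omega=\bigcup_n\check\omega_n$. For $M\in\hat\omega$, $\omega\text{-}\dim M$ is the least $n$ with $M\in\hat\omega_n$. For $\omega$ self-orthogonal, ${}_{\omega}\mathscr{X}$ is the class of $A$ admitting an $\mathbb{E}$-triangle sequence $\cdots\to W_1\to W_0\to A$, spliced from $\mathbb{E}$-triangles $K_{i+1}\to W_i\to K_i\dashrightarrow$ ($i\ge 0$, $K_0=A$), with all $W_i\in\omega$ and all $K_i\in\omega^{\bot}$. A pair $(\mathcal{C},\mathcal{T})$ of subcategories is a tilting pair if $\mathcal{C}$ and $\mathcal{T}$ are self-orthogonal, $\mathcal{T}\subseteq\hat{\mathcal{C}}$ and $\mathcal{C}\subseteq\check{\mathcal{T}}$; it is an $n$-tilting pair if moreover $\mathcal{C}\text{-}\dim M\le n$ for all $M\in\mathcal{T}$. $\omega$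 is strongly contravariantly finite in $\mathfrak{C}$ if for every $C\in\mathfrak{C}$ there is an $\mathbb{E}$-triangle $K\to W\xrightarrow{g}C\dashrightarrow$ with $g$ a right $\omega$-approximation of $C$ (i.e. $W\in\omega$ and every morphism from an object of $\omega$ to $C$ factors through $g$). For subcategories $\mathcal{T}_1,\mathcal{T}_2$ and an integer $n\ge1$: $\mathrm{Pres}^{n}_{\mathcal{T}_2}(\mathcal{T}_1)$ is the class of $X$ admitting an $\mathbb{E}$-triangle sequence $X'\to T_n\to\cdots\to T_1\to X$ with $T_i\in\mathcal{T}_1$, $X'\in\mathcal{T}_2$; $\mathrm{Copres}^{n}(\mathcal{T}_1)$ is the class of $X$ admitting an $\mathbb{E}$-triangle sequence $X\to T_1\to\cdots\to T_n\to X'$ with $T_i\in\mathcal{T}_1$ and $X'\in\mathfrak{C}$ arbitrary. *)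

theory Defs
  imports "HOL-Algebra.Ring"
begin

section \<open>Data of an extriangulated category\<close>

text \<open>
  \<open>Ext X C A\<close> is the extension group \<open>E(C, A)\<close> (contravariant in \<open>C\<close>, covariant in \<open>A\<close>);
  \<open>push X a \<delta>\<close> is \<open>a\<^sub>* \<delta>\<close> and \<open>pull X c \<delta>\<close> is \<open>c\<^sup>* \<delta>\<close>. The realization \<open>rlz X \<delta>\<close> is the
  equivalence class of a sequence \<open>A \<rightarrow> B \<rightarrow> C\<close>, as the set of the pairs of morphisms belonging to it.
  Composition \<open>g \<cdot> f\<close> is written in function order.
\<close>

record ('o, 'm, 'e) extri_data =
  Ob :: "'o set"
  Hom :: "'o \<Rightarrow> 'o \<Rightarrow> 'm set"
  Cmp :: "'m \<Rightarrow> 'm \<Rightarrow> 'm"  (infixl "\<cdot>\<index>" 75)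
  Idn :: "'o \<Rightarrow> 'm"
  Hadd :: "'m \<Rightarrow> 'm \<Rightarrow> 'm"
  Hzero :: "'o \<Rightarrow> 'o \<Rightarrow> 'm"
  Ext :: "'o \<Rightarrow> 'o \<Rightarrow> 'e set"
  Eadd :: "'e \<Rightarrow> 'e \<Rightarrow> 'e"
  Ezero :: "'o \<Rightarrow> 'o \<Rightarrow> 'e"
  push :: "'m \<Rightarrow> 'e \<Rightarrow> 'e"
  pull :: "'m \<Rightarrow> 'e \<Rightarrow> 'e"
  rlz :: "'e \<Rightarrow> ('m \<times> 'm) set"

text \<open>The abelian groups below are multiplicative records in the sense of HOL-Algebra, so
  that \<open>mult\<close> is the addition and \<open>one\<close> is the zero element.\<close>

definition hom_group :: "('o, 'm, 'e) extri_data \<Rightarrow> 'o \<Rightarrow> 'o \<Rightarrow> 'm monoid" where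
  "hom_group X A B = \<lparr>carrier = Hom X A B, mult = Hadd X, one = Hzero X A B\<rparr>"

definition ext_group :: "('o, 'm, 'e) extri_data \<Rightarrow> 'o \<Rightarrow> 'o \<Rightarrow> 'e monoid" where
  "ext_group X C A = \<lparr>carrier = Ext X C A, mult = Eadd X, one = Ezero X C A\<rparr>"

definition end_ring :: "('o, 'm, 'e) extri_data \<Rightarrow> 'o \<Rightarrow> 'm ring" where
  "end_ring X A = \<lparr>carrier = Hom X A A, mult = Cmp X, one = Idn X A,
                   zero = Hzero X A A, add = Hadd X\<rparr>"

section \<open>Additive categories\<close>

text \<open>The usual convention that distinct hom-sets are disjoint lets composition and addition be
  written without mentioning objects.\<close>

locale category_ax =
  fixes X :: "('o, 'm, 'e) extri_data" (structure)
  assumes Hom_Ob: "f \<in> Hom X A B \<Longrightarrow> A \<in> Ob X \<and> B \<in> Ob X"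
    and Hom_disjoint: "f \<in> Hom X A B \<Longrightarrow> f \<in> Hom X A' B' \<Longrightarrow> A = A' \<and> B = B'"
    and Idn_Hom: "A \<in> Ob X \<Longrightarrow> Idn X A \<in> Hom X A A"
    and Cmp_Hom: "f \<in> Hom X A B \<Longrightarrow> g \<in> Hom X B C \<Longrightarrow> g \<cdot> f \<in> Hom X A C"
    and Cmp_Idn_left: "f \<in> Hom X A B \<Longrightarrow> Idn X B \<cdot> f = f"
    and Cmp_Idn_right: "f \<in> Hom X A B \<Longrightarrow> f \<cdot> Idn X A = f"
    and Cmp_assoc: "f \<in> Hom X A B \<Longrightarrow> g \<in> Hom X B C \<Longrightarrow> h \<in> Hom X C D \<Longrightarrow>
                      (h \<cdot> g) \<cdot> f = h \<cdot> (g \<cdot> f)"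

locale preadditive_category = category_ax +
  assumes hom_comm_group: "A \<in> Ob X \<Longrightarrow> B \<in> Ob X \<Longrightarrow> comm_group (hom_group X A B)"
    and Cmp_add_right: "f \<in> Hom X A B \<Longrightarrow> f' \<in> Hom X A B \<Longrightarrow> g \<in> Hom X B C \<Longrightarrow>
                          g \<cdot> Hadd X f f' = Hadd X (g \<cdot> f) (g \<cdot> f')"
    and Cmp_add_left: "f \<in> Hom X A B \<Longrightarrow> g \<in> Hom X B C \<Longrightarrow> g' \<in> Hom X B C \<Longrightarrow>
                          Hadd X g g' \<cdot> f = Hadd X (g \<cdot> f) (g' \<cdot> f)"

definition is_iso :: "('o, 'm, 'e) extri_data \<Rightarrow> 'm \<Rightarrow> 'o \<Rightarrow> 'o \<Rightarrow> bool" where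
  "is_iso X f A B \<longleftrightarrow> f \<in> Hom X A B \<and>
     (\<exists>g\<in>Hom X B A. g \<cdot>\<^bsub>X\<^esub> f = Idn X A \<and> f \<cdot>\<^bsub>X\<^esub> g = Idn X B)"

definition isomorphic :: "('o, 'm, 'e) extri_data \<Rightarrow> 'o \<Rightarrow> 'o \<Rightarrow> bool" where
  "isomorphic X A B \<longleftrightarrow> (\<exists>f. is_iso X f A B)"

definition zero_object :: "('o, 'm, 'e) extri_data \<Rightarrow> 'o \<Rightarrow> bool" where
  "zero_object X Z \<longleftrightarrow> Z \<in> Ob X \<and>
     (\<forall>A\<in>Ob X. (\<exists>!f. f \<in> Hom X Z A) \<and> (\<exists>!f. f \<in> Hom X A Z))"

definition biproduct ::
  "('o, 'm, 'e) extri_data \<Rightarrow> 'o \<Rightarrow> 'o \<Rightarrow> 'o \<Rightarrow> 'm \<Rightarrow> 'm \<Rightarrow> 'm \<Rightarrow> 'm \<Rightarrow> bool" where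
  "biproduct X A B S i1 i2 p1 p2 \<longleftrightarrow>
     i1 \<in> Hom X A S \<and> i2 \<in> Hom X B S \<and> p1 \<in> Hom X S A \<and> p2 \<in> Hom X S B \<and>
     p1 \<cdot>\<^bsub>X\<^esub> i1 = Idn X A \<and> p2 \<cdot>\<^bsub>X\<^esub> i2 = Idn X B \<and>
     p1 \<cdot>\<^bsub>X\<^esub> i2 = Hzero X B A \<and> p2 \<cdot>\<^bsub>X\<^esub> i1 = Hzero X A B \<and>
     Hadd X (i1 \<cdot>\<^bsub>X\<^esub> p1) (i2 \<cdot>\<^bsub>X\<^esub> p2) = Idn X S"

definition direct_sum_of :: "('o, 'm, 'e) extri_data \<Rightarrow> 'o \<Rightarrow> 'o \<Rightarrow> 'o \<Rightarrow> bool" where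
  "direct_sum_of X S A B \<longleftrightarrow> (\<exists>i1 i2 p1 p2. biproduct X A B S i1 i2 p1 p2)"

locale additive_category = preadditive_category +
  assumes ex_zero_object: "\<exists>Z. zero_object X Z"
    and ex_direct_sum: "A \<in> Ob X \<Longrightarrow> B \<in> Ob X \<Longrightarrow> \<exists>S. direct_sum_of X S A B"

definition finite_biproduct ::
  "('o, 'm, 'e) extri_data \<Rightarrow> nat \<Rightarrow> (nat \<Rightarrow> 'o) \<Rightarrow> 'o \<Rightarrow> (nat \<Rightarrow> 'm) \<Rightarrow> (nat \<Rightarrow> 'm) \<Rightarrow> bool" where
  "finite_biproduct X n Y S i p \<longleftrightarrow> S \<in> Ob X \<and>
     (\<forall>k<n. i k \<in> Hom X (Y k) S \<and> p k \<in> Hom X S (Y k)) \<and>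
     (\<forall>j<n. \<forall>k<n. p j \<cdot>\<^bsub>X\<^esub> i k = (if j = k then Idn X (Y k) else Hzero X (Y k) (Y j))) \<and>
     finprod (hom_group X S S) (\<lambda>k. i k \<cdot>\<^bsub>X\<^esub> p k) {..<n} = Idn X S"

text \<open>A possibly noncommutative ring is local if it is nonzero and the sum of two nonunits is a
  nonunit.\<close>

definition local_ring :: "'a ring \<Rightarrow> bool" where
  "local_ring R \<longleftrightarrow> ring R \<and> \<one>\<^bsub>R\<^esub> \<noteq> \<zero>\<^bsub>R\<^esub> \<and>
     (\<forall>a\<in>carrier R - Units R. \<forall>b\<in>carrier R - Units R. a \<oplus>\<^bsub>R\<^esub> b \<notin> Units R)"

definition krull_schmidt :: "('o, 'm, 'e) extri_data \<Rightarrow> bool" where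
  "krull_schmidt X \<longleftrightarrow> (\<forall>S\<in>Ob X. \<exists>n Y i p. finite_biproduct X n Y S i p \<and>
     (\<forall>k<n. local_ring (end_ring X (Y k))))"

section \<open>Extriangulated categories (Nakaoka--Palu)\<close>

definition seq_class :: "('o, 'm, 'e) extri_data \<Rightarrow> 'o \<Rightarrow> 'm \<Rightarrow> 'm \<Rightarrow> ('m \<times> 'm) set" where
  "seq_class X B x y =
     {(x', y'). \<exists>B' b b'. b \<in> Hom X B B' \<and> b' \<in> Hom X B' B \<and>
        b' \<cdot>\<^bsub>X\<^esub> b = Idn X B \<and> b \<cdot>\<^bsub>X\<^esub> b' = Idn X B' \<and>
        x' = b \<cdot>\<^bsub>X\<^esub> x \<and> y' = y \<cdot>\<^bsub>X\<^esub> b'}"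

definition etriangle ::
  "('o, 'm, 'e) extri_data \<Rightarrow> 'o \<Rightarrow> 'o \<Rightarrow> 'o \<Rightarrow> 'm \<Rightarrow> 'm \<Rightarrow> 'e \<Rightarrow> bool" where
  "etriangle X A B C x y \<delta> \<longleftrightarrow>
     \<delta> \<in> Ext X C A \<and> x \<in> Hom X A B \<and> y \<in> Hom X B C \<and> (x, y) \<in> rlz X \<delta>"

text \<open>(ET1): \<open>E\<close> is a biadditive functor to abelian groups. The groups are taken pairwise disjoint,
  like hom-sets, so that an extension determines its end terms.\<close>

locale ext_bifunctor = additive_category +
  assumes Ext_Ob: "\<delta> \<in> Ext X C A \<Longrightarrow> C \<in> Ob X \<and> A \<in> Ob X"
    and Ext_disjoint: "\<delta> \<in> Ext X C A \<Longrightarrow> \<delta> \<in> Ext X C' A' \<Longrightarrow> C = C' \<and> A = A'"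
    and ext_comm_group: "C \<in> Ob X \<Longrightarrow> A \<in> Ob X \<Longrightarrow> comm_group (ext_group X C A)"
    and push_hom: "a \<in> Hom X A A' \<Longrightarrow> C \<in> Ob X \<Longrightarrow>
                     push X a \<in> hom (ext_group X C A) (ext_group X C A')"
    and pull_hom: "c \<in> Hom X C' C \<Longrightarrow> A \<in> Ob X \<Longrightarrow>
                     pull X c \<in> hom (ext_group X C A) (ext_group X C' A)"
    and push_Idn: "\<delta> \<in> Ext X C A \<Longrightarrow> push X (Idn X A) \<delta> = \<delta>"
    and pull_Idn: "\<delta> \<in> Ext X C A \<Longrightarrow> pull X (Idn X C) \<delta> = \<delta>"
    and push_Cmp: "\<delta> \<in> Ext X C A \<Longrightarrow> a \<in> Hom X A A' \<Longrightarrow> a' \<in> Hom X A' A'' \<Longrightarrow>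
                     push X (a' \<cdot> a) \<delta> = push X a' (push X a \<delta>)"
    and pull_Cmp: "\<delta> \<in> Ext X C A \<Longrightarrow> c \<in> Hom X C' C \<Longrightarrow> c' \<in> Hom X C'' C' \<Longrightarrow>
                     pull X (c \<cdot> c') \<delta> = pull X c' (pull X c \<delta>)"
    and push_pull: "\<delta> \<in> Ext X C A \<Longrightarrow> a \<in> Hom X A A' \<Longrightarrow> c \<in> Hom X C' C \<Longrightarrow>
                     push X a (pull X c \<delta>) = pull X c (push X a \<delta>)"
    and push_add: "\<delta> \<in> Ext X C A \<Longrightarrow> a \<in> Hom X A A' \<Longrightarrow> a' \<in> Hom X A A' \<Longrightarrow>
                     push X (Hadd X a a') \<delta> = Eadd X (push X a \<delta>) (push X a' \<delta>)"
    and pull_add: "\<delta> \<in> Ext X C A \<Longrightarrow> c \<in> Hom X C' C \<Longrightarrow> c' \<in> Hom X C' C \<Longrightarrow>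
                     pull X (Hadd X c c') \<delta> = Eadd X (pull X c \<delta>) (pull X c' \<delta>)"

text \<open>(ET2): the class assignment is an additive realization. In \<open>rlz_sum\<close> the extension on the
  right is the direct sum \<open>\<delta> \<oplus> \<delta>'\<close>.\<close>

locale additive_realization = ext_bifunctor +
  assumes rlz_class: "\<delta> \<in> Ext X C A \<Longrightarrow>
      \<exists>B x y. x \<in> Hom X A B \<and> y \<in> Hom X B C \<and> rlz X \<delta> = seq_class X B x y"
    and rlz_morphism: "etriangle X A B C x y \<delta> \<Longrightarrow> etriangle X A' B' C' x' y' \<delta>' \<Longrightarrow>
      a \<in> Hom X A A' \<Longrightarrow> c \<in> Hom X C C' \<Longrightarrow> push X a \<delta> = pull X c \<delta>' \<Longrightarrow>
      \<exists>b\<in>Hom X B B'. b \<cdot> x = x' \<cdot> a \<and> y' \<cdot> b = c \<cdot> y"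
    and rlz_zero: "biproduct X A C S i1 i2 p1 p2 \<Longrightarrow> (i1, p2) \<in> rlz X (Ezero X C A)"
    and rlz_sum: "etriangle X A B C x y \<delta> \<Longrightarrow> etriangle X A' B' C' x' y' \<delta>' \<Longrightarrow>
      biproduct X A A' SA iA iA' pA pA' \<Longrightarrow>
      biproduct X B B' SB iB iB' pB pB' \<Longrightarrow>
      biproduct X C C' SC iC iC' pC pC' \<Longrightarrow>
      (Hadd X (iB \<cdot> x \<cdot> pA) (iB' \<cdot> x' \<cdot> pA'), Hadd X (iC \<cdot> y \<cdot> pB) (iC' \<cdot> y' \<cdot> pB'))
        \<in> rlz X (Eadd X (push X iA (pull X pC \<delta>)) (push X iA' (pull X pC' \<delta>')))"

locale extriangulated_category = additive_realization +
  assumes ET3: "etriangle X A B C x y \<delta> \<Longrightarrow> etriangle X A' B' C' x' y' \<delta>' \<Longrightarrow>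
      a \<in> Hom X A A' \<Longrightarrow> b \<in> Hom X B B' \<Longrightarrow> b \<cdot> x = x' \<cdot> a \<Longrightarrow>
      \<exists>c\<in>Hom X C C'. c \<cdot> y = y' \<cdot> b \<and> push X a \<delta> = pull X c \<delta>'"
    and ET3_op: "etriangle X A B C x y \<delta> \<Longrightarrow> etriangle X A' B' C' x' y' \<delta>' \<Longrightarrow>
      b \<in> Hom X B B' \<Longrightarrow> c \<in> Hom X C C' \<Longrightarrow> c \<cdot> y = y' \<cdot> b \<Longrightarrow>
      \<exists>a\<in>Hom X A A'. b \<cdot> x = x' \<cdot> a \<and> push X a \<delta> = pull X c \<delta>'"
    and ET4: "etriangle X A B D f f' \<delta> \<Longrightarrow> etriangle X B C F g g' \<delta>' \<Longrightarrow>
      \<exists>E h' d e \<delta>''. etriangle X A C E (g \<cdot> f) h' \<delta>'' \<and>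
        etriangle X D E F d e (push X f' \<delta>') \<and>
        h' \<cdot> g = d \<cdot> f' \<and> e \<cdot> h' = g' \<and>
        pull X d \<delta>'' = \<delta> \<and> push X f \<delta>'' = pull X e \<delta>'"
    and ET4_op: "etriangle X D B A f' f \<delta> \<Longrightarrow> etriangle X F C B g' g \<delta>' \<Longrightarrow>
      \<exists>E h' d e \<delta>''. etriangle X E C A h' (f \<cdot> g) \<delta>'' \<and>
        etriangle X F E D e d (pull X f' \<delta>') \<and>
        g \<cdot> h' = f' \<cdot> d \<and> h' \<cdot> e = g' \<and>
        push X d \<delta>'' = \<delta> \<and> pull X f \<delta>'' = push X e \<delta>'"

definition is_etriangle :: "('o, 'm, 'e) extri_data \<Rightarrow> 'o \<Rightarrow> 'o \<Rightarrow> 'o \<Rightarrow> bool" where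
  "is_etriangle X A B C \<longleftrightarrow> (\<exists>x y \<delta>. etriangle X A B C x y \<delta>)"

definition inflation :: "('o, 'm, 'e) extri_data \<Rightarrow> 'm \<Rightarrow> bool" where
  "inflation X x \<longleftrightarrow> (\<exists>A B C y \<delta>. etriangle X A B C x y \<delta>)"

definition deflation :: "('o, 'm, 'e) extri_data \<Rightarrow> 'm \<Rightarrow> bool" where
  "deflation X y \<longleftrightarrow> (\<exists>A B C x \<delta>. etriangle X A B C x y \<delta>)"

definition WIC :: "('o, 'm, 'e) extri_data \<Rightarrow> bool" where
  "WIC X \<longleftrightarrow> (\<forall>A B C. \<forall>f\<in>Hom X A B. \<forall>g\<in>Hom X B C.
     (inflation X (g \<cdot>\<^bsub>X\<^esub> f) \<longrightarrow> inflation X f) \<and>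
     (deflation X (g \<cdot>\<^bsub>X\<^esub> f) \<longrightarrow> deflation X g))"

definition projective :: "('o, 'm, 'e) extri_data \<Rightarrow> 'o \<Rightarrow> bool" where
  "projective X P \<longleftrightarrow> P \<in> Ob X \<and> (\<forall>A B C x y \<delta>. etriangle X A B C x y \<delta> \<longrightarrow>
     (\<forall>c\<in>Hom X P C. \<exists>b\<in>Hom X P B. y \<cdot>\<^bsub>X\<^esub> b = c))"

definition injective :: "('o, 'm, 'e) extri_data \<Rightarrow> 'o \<Rightarrow> bool" where
  "injective X I \<longleftrightarrow> I \<in> Ob X \<and> (\<forall>A B C x y \<delta>. etriangle X A B C x y \<delta> \<longrightarrow>
     (\<forall>a\<in>Hom X A I. \<exists>b\<in>Hom X B I. b \<cdot>\<^bsub>X\<^esub> x = a))"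

definition enough_projectives :: "('o, 'm, 'e) extri_data \<Rightarrow> bool" where
  "enough_projectives X \<longleftrightarrow> (\<forall>C\<in>Ob X. \<exists>K P. projective X P \<and> is_etriangle X K P C)"

definition enough_injectives :: "('o, 'm, 'e) extri_data \<Rightarrow> bool" where
  "enough_injectives X \<longleftrightarrow> (\<forall>A\<in>Ob X. \<exists>I K. injective X I \<and> is_etriangle X A I K)"

section \<open>Higher extensions\<close>

definition syzygy :: "('o, 'm, 'e) extri_data \<Rightarrow> 'o \<Rightarrow> 'o" where
  "syzygy X C = (SOME K. \<exists>P. projective X P \<and> is_etriangle X K P C)"

text \<open>The group \<open>E\<^sup>i(C, A) = E(\<Omega>\<^sup>i\<^sup>-\<^sup>1 C, A)\<close>, meaningful only for \<open>i \<ge> 1\<close>. Up to isomorphism it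
  does not depend on the chosen syzygies and equals \<open>E(C, \<Sigma>\<^sup>i\<^sup>-\<^sup>1 A)\<close>.\<close>

definition higher_ext :: "('o, 'm, 'e) extri_data \<Rightarrow> nat \<Rightarrow> 'o \<Rightarrow> 'o \<Rightarrow> 'e monoid" where
  "higher_ext X i C A = ext_group X ((syzygy X ^^ (i - 1)) C) A"

section \<open>Subcategories and tilting pairs\<close>

text \<open>Full subcategories are given by their sets of objects.\<close>

definition subcategory :: "('o, 'm, 'e) extri_data \<Rightarrow> 'o set \<Rightarrow> bool" where
  "subcategory X \<omega> \<longleftrightarrow> \<omega> \<subseteq> Ob X \<and>
     (\<exists>Z\<in>\<omega>. zero_object X Z) \<and>
     (\<forall>A\<in>\<omega>. \<forall>B\<in>\<omega>. \<forall>S. direct_sum_of X S A B \<longrightarrow> S \<in> \<omega>) \<and>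
     (\<forall>A\<in>\<omega>. \<forall>B. isomorphic X A B \<longrightarrow> B \<in> \<omega>) \<and>
     (\<forall>S\<in>\<omega>. \<forall>A B. direct_sum_of X S A B \<longrightarrow> A \<in> \<omega>)"

definition right_perp :: "('o, 'm, 'e) extri_data \<Rightarrow> 'o set \<Rightarrow> 'o set" where
  "right_perp X \<omega> = {Y \<in> Ob X. \<forall>i\<ge>1. \<forall>W\<in>\<omega>.
     carrier (higher_ext X i W Y) = {\<one>\<^bsub>higher_ext X i W Y\<^esub>}}"

definition self_orthogonal :: "('o, 'm, 'e) extri_data \<Rightarrow> 'o set \<Rightarrow> bool" where
  "self_orthogonal X \<omega> \<longleftrightarrow> \<omega> \<subseteq> right_perp X \<omega>"

text \<open>In each \<open>E\<close>-triangle sequence below, \<open>K\<close> lists the objects at which the \<open>E\<close>-triangles are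
  spliced, including both end terms of the sequence. In particular a resolution
  \<open>W\<^sub>n \<rightarrow> \<dots> \<rightarrow> W\<^sub>0 \<rightarrow> A\<close> has \<open>K 0 = A\<close> and \<open>K n = W\<^sub>n\<close>.\<close>

definition res_le :: "('o, 'm, 'e) extri_data \<Rightarrow> 'o set \<Rightarrow> nat \<Rightarrow> 'o set" where
  "res_le X \<omega> n = {A. \<exists>K W. K 0 = A \<and> K n \<in> \<omega> \<and>
     (\<forall>i<n. W i \<in> \<omega> \<and> is_etriangle X (K (Suc i)) (W i) (K i))}"

definition cores_le :: "('o, 'm, 'e) extri_data \<Rightarrow> 'o set \<Rightarrow> nat \<Rightarrow> 'o set" where
  "cores_le X \<omega> n = {A. \<exists>K W. K 0 = A \<and> K n \<in> \<omega> \<and>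
     (\<forall>i<n. W i \<in> \<omega> \<and> is_etriangle X (K i) (W i) (K (Suc i)))}"

definition res_finite :: "('o, 'm, 'e) extri_data \<Rightarrow> 'o set \<Rightarrow> 'o set" where
  "res_finite X \<omega> = (\<Union>n. res_le X \<omega> n)"

definition cores_finite :: "('o, 'm, 'e) extri_data \<Rightarrow> 'o set \<Rightarrow> 'o set" where
  "cores_finite X \<omega> = (\<Union>n. cores_le X \<omega> n)"

text \<open>Meaningful only for \<open>M \<in> res_finite X \<omega>\<close>.\<close>

definition res_dim :: "('o, 'm, 'e) extri_data \<Rightarrow> 'o set \<Rightarrow> 'o \<Rightarrow> nat" where
  "res_dim X \<omega> M = (LEAST n. M \<in> res_le X \<omega> n)"

text \<open>The class \<open>\<^sub>\<omega>\<X>\<close>.\<close>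

definition res_perp :: "('o, 'm, 'e) extri_data \<Rightarrow> 'o set \<Rightarrow> 'o set" where
  "res_perp X \<omega> = {A. \<exists>K W. K 0 = A \<and>
     (\<forall>i. W i \<in> \<omega> \<and> K i \<in> right_perp X \<omega> \<and> is_etriangle X (K (Suc i)) (W i) (K i))}"

definition tilting_pair :: "('o, 'm, 'e) extri_data \<Rightarrow> 'o set \<Rightarrow> 'o set \<Rightarrow> bool" where
  "tilting_pair X \<C> \<T> \<longleftrightarrow> subcategory X \<C> \<and> subcategory X \<T> \<and>
     self_orthogonal X \<C> \<and> self_orthogonal X \<T> \<and>
     \<T> \<subseteq> res_finite X \<C> \<and> \<C> \<subseteq> cores_finite X \<T>"

definition n_tilting_pair :: "('o, 'm, 'e) extri_data \<Rightarrow> nat \<Rightarrow> 'o set \<Rightarrow> 'o set \<Rightarrow> bool" where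
  "n_tilting_pair X n \<C> \<T> \<longleftrightarrow> tilting_pair X \<C> \<T> \<and> (\<forall>M\<in>\<T>. res_dim X \<C> M \<le> n)"

definition right_approximation ::
  "('o, 'm, 'e) extri_data \<Rightarrow> 'o set \<Rightarrow> 'o \<Rightarrow> 'o \<Rightarrow> 'm \<Rightarrow> bool" where
  "right_approximation X \<omega> W C g \<longleftrightarrow> W \<in> \<omega> \<and> g \<in> Hom X W C \<and>
     (\<forall>W'\<in>\<omega>. \<forall>f\<in>Hom X W' C. \<exists>h\<in>Hom X W' W. g \<cdot>\<^bsub>X\<^esub> h = f)"

definition strongly_contravariantly_finite ::
  "('o, 'm, 'e) extri_data \<Rightarrow> 'o set \<Rightarrow> bool" where
  "strongly_contravariantly_finite X \<omega> \<longleftrightarrow> (\<forall>C\<in>Ob X. \<exists>K W k g \<delta>.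
     etriangle X K W C k g \<delta> \<and> right_approximation X \<omega> W C g)"

text \<open>\<open>Pres X n \<T>\<^sub>2 \<T>\<^sub>1\<close> and \<open>Copres X n \<T>\<^sub>1\<close> are used for \<open>n \<ge> 1\<close>. The index of the middle terms is
  shifted: \<open>W i\<close> is \<open>T\<^sub>i\<^sub>+\<^sub>1\<close>.\<close>

definition Pres :: "('o, 'm, 'e) extri_data \<Rightarrow> nat \<Rightarrow> 'o set \<Rightarrow> 'o set \<Rightarrow> 'o set" where
  "Pres X n \<T>2 \<T>1 = {A. \<exists>K W. K 0 = A \<and> K n \<in> \<T>2 \<and>
     (\<forall>i<n. W i \<in> \<T>1 \<and> is_etriangle X (K (Suc i)) (W i) (K i))}"

definition Copres :: "('o, 'm, 'e) extri_data \<Rightarrow> nat \<Rightarrow> 'o set \<Rightarrow> 'o set" where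
  "Copres X n \<T>1 = {A. \<exists>K W. K 0 = A \<and> K n \<in> Ob X \<and>
     (\<forall>i<n. W i \<in> \<T>1 \<and> is_etriangle X (K i) (W i) (K (Suc i)))}"

end

theory Submission
  imports Defs
begin

text \<open>
  Put \<open>\<X> = \<^sub>\<C>\<X>\<close> and \<open>\<P> = \<T>\<^sup>\<bottom> \<inter> \<X>\<close>. The class \<open>\<X>\<close> is closed under extensions and cones.

  If \<open>(\<C>, \<T>)\<close> is \<open>n\<close>-tilting, then \<open>E\<^sup>i(\<T>, \<X>) = 0\<close> for \<open>i > n\<close>, so dimension shifting puts \<open>Pres\<close> inside
  \<open>\<P>\<close>; conversely the cocone of a right \<open>\<T>\<close>-approximation of an object of \<open>\<P>\<close> lies in \<open>\<P>\<close> again,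
  and iterating gives a presentation.

  If \<open>Pres = \<P>\<close>, then objects of \<open>\<P>\<close> have \<open>\<T>\<close>-covers with cocone in \<open>\<P>\<close>, so presenting by \<open>\<P>\<close>
  instead of \<open>\<T>\<close> gives nothing new. Hence the copresentations of objects of \<open>\<C>\<close> are finite
  \<open>\<P>\<close>-coresolutions, and an Auslander--Buchweitz argument gives \<open>C \<rightarrow> Q \<rightarrow> F\<close> with \<open>Q \<in> \<P>\<close> and \<open>F\<close>
  having a finite \<open>\<T>\<close>-coresolution. Pulling a \<open>\<T>\<close>-cover of \<open>Q\<close> back to \<open>C\<close> splits and yields the
  \<open>\<T>\<close>-coresolution of \<open>C\<close>. Gluing these envelopes along a \<open>\<C>\<close>-resolution embeds every \<open>Y \<in> \<X>\<close> in an
  object of \<open>\<P>\<close> with cone in \<open>\<X>\<close>; after \<open>n\<close> such steps the cone is in \<open>\<P>\<close>, so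
  \<open>E\<^sup>n\<^sup>+\<^sup>1(\<T>, Y) = 0\<close> and the \<open>n\<close>-th \<open>\<C>\<close>-syzygies of objects of \<open>\<T>\<close> lie in \<open>\<C>\<close>.
\<close>

section \<open>Additive categories and extension groups\<close>

context preadditive_category
begin

lemma Hzero_Hom: "A \<in> Ob X \<Longrightarrow> B \<in> Ob X \<Longrightarrow> Hzero X A B \<in> Hom X A B"
  using comm_group.axioms(2)[OF hom_comm_group] group.is_monoid monoid.one_closed
  by (fastforce simp: hom_group_def)

lemma Hadd_Hom: "f \<in> Hom X A B \<Longrightarrow> g \<in> Hom X A B \<Longrightarrow> Hadd X f g \<in> Hom X A B"
  using comm_group.axioms(2)[OF hom_comm_group, of A B] Hom_Ob[of f A B]
    monoid.m_closed[of "hom_group X A B" f g] group.is_monoid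
  by (fastforce simp: hom_group_def)

lemma Hadd_comm: "f \<in> Hom X A B \<Longrightarrow> g \<in> Hom X A B \<Longrightarrow> Hadd X f g = Hadd X g f"
  using comm_group.axioms(1)[OF hom_comm_group, of A B] Hom_Ob[of f A B]
    comm_monoid.m_comm[of "hom_group X A B" f g]
  by (fastforce simp: hom_group_def)

lemma Hadd_assoc:
  "f \<in> Hom X A B \<Longrightarrow> g \<in> Hom X A B \<Longrightarrow> h \<in> Hom X A B \<Longrightarrow>
    Hadd X (Hadd X f g) h = Hadd X f (Hadd X g h)"
  using comm_group.axioms(2)[OF hom_comm_group, of A B] Hom_Ob[of f A B]
    monoid.m_assoc[of "hom_group X A B" f g h] group.is_monoid
  by (fastforce simp: hom_group_def)

lemma Hadd_Hzero_left: "f \<in> Hom X A B \<Longrightarrow> Hadd X (Hzero X A B) f = f"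
  using comm_group.axioms(2)[OF hom_comm_group, of A B] Hom_Ob[of f A B]
    monoid.l_one[of "hom_group X A B" f] group.is_monoid
  by (fastforce simp: hom_group_def)

lemma Hadd_Hzero_right: "f \<in> Hom X A B \<Longrightarrow> Hadd X f (Hzero X A B) = f"
  using Hadd_Hzero_left Hadd_comm Hzero_Hom Hom_Ob by metis

lemma ex_Hneg: "f \<in> Hom X A B \<Longrightarrow> \<exists>g\<in>Hom X A B. Hadd X g f = Hzero X A B"
  using comm_group.axioms(2)[OF hom_comm_group, of A B] Hom_Ob[of f A B]
    group.l_inv_ex[of "hom_group X A B" f]
  by (fastforce simp: hom_group_def)

lemma Hadd_idem:
  assumes "f \<in> Hom X A B" "Hadd X f f = f" shows "f = Hzero X A B"
  using assms ex_Hneg[OF assms(1)] Hadd_assoc Hadd_Hzero_left by metis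

lemma Cmp_Hzero_right:
  assumes "g \<in> Hom X B C" "A \<in> Ob X" shows "g \<cdot> Hzero X A B = Hzero X A C"
proof -
  have z: "Hzero X A B \<in> Hom X A B" using assms Hom_Ob Hzero_Hom by blast
  show ?thesis
    using Hadd_idem[OF Cmp_Hom[OF z assms(1)]] Cmp_add_right[OF z z assms(1)] Hadd_Hzero_left[OF z]
    by simp
qed

lemma Cmp_Hzero_left:
  assumes "f \<in> Hom X A B" "C \<in> Ob X" shows "Hzero X B C \<cdot> f = Hzero X A C"
proof -
  have z: "Hzero X B C \<in> Hom X B C" using assms Hom_Ob Hzero_Hom by blast
  show ?thesis
    using Hadd_idem[OF Cmp_Hom[OF assms(1) z]] Cmp_add_left[OF assms(1) z z] Hadd_Hzero_left[OF z]
    by simp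
qed

lemma biproduct_Ob:
  assumes "biproduct X A B S i1 i2 p1 p2" shows "A \<in> Ob X" "B \<in> Ob X" "S \<in> Ob X"
  using assms Hom_Ob unfolding biproduct_def by blast+

lemma biproduct_swap:
  assumes "biproduct X A B S i1 i2 p1 p2" shows "biproduct X B A S i2 i1 p2 p1"
proof -
  have "Hadd X (i2 \<cdot> p2) (i1 \<cdot> p1) = Hadd X (i1 \<cdot> p1) (i2 \<cdot> p2)"
    using assms unfolding biproduct_def by (meson Cmp_Hom Hadd_comm)
  thus ?thesis using assms unfolding biproduct_def by simp
qed

lemma direct_sum_of_swap: "direct_sum_of X S A B \<Longrightarrow> direct_sum_of X S B A"
  unfolding direct_sum_of_def using biproduct_swap by blast

lemma biproduct_zero_object:
  assumes "zero_object X Z" "A \<in> Ob X"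
  shows "biproduct X Z A A (Hzero X Z A) (Idn X A) (Hzero X A Z) (Idn X A)"
proof -
  have Z: "Z \<in> Ob X" using assms(1) by (simp add: zero_object_def)
  note h = Hzero_Hom[OF Z assms(2)] Hzero_Hom[OF assms(2) Z] Idn_Hom[OF assms(2)] Idn_Hom[OF Z]
  have "Hzero X A Z \<cdot> Hzero X Z A = Idn X Z"
    using assms(1) Z h Cmp_Hom[OF h(1) h(2)] unfolding zero_object_def by blast
  moreover have "Hadd X (Hzero X Z A \<cdot> Hzero X A Z) (Idn X A \<cdot> Idn X A) = Idn X A"
    using Cmp_Hzero_left[OF h(2) assms(2)] Hadd_Hzero_left[OF h(3)] Cmp_Idn_left[OF h(3)]
    by simp
  ultimately show ?thesis
    using h Cmp_Idn_left Cmp_Idn_right unfolding biproduct_def by simp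
qed

lemma zero_objects_isomorphic:
  assumes "zero_object X Z" "zero_object X Z'" shows "isomorphic X Z Z'"
proof -
  have Z: "Z \<in> Ob X" "Z' \<in> Ob X" using assms by (auto simp: zero_object_def)
  note h = Hzero_Hom[OF Z] Hzero_Hom[OF Z(2) Z(1)]
  have "Hzero X Z' Z \<cdot> Hzero X Z Z' = Idn X Z"
    using assms(1) Z Cmp_Hom[OF h] Idn_Hom[OF Z(1)] unfolding zero_object_def by blast
  moreover have "Hzero X Z Z' \<cdot> Hzero X Z' Z = Idn X Z'"
    using assms(2) Z Cmp_Hom[OF h(2) h(1)] Idn_Hom[OF Z(2)] unfolding zero_object_def by blast
  ultimately show ?thesis using h unfolding isomorphic_def is_iso_def by blast
qed

lemma biproduct_iso:
  assumes "biproduct X A B S i1 i2 p1 p2"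
    and b: "b \<in> Hom X S S'" "b' \<in> Hom X S' S" "b' \<cdot> b = Idn X S" "b \<cdot> b' = Idn X S'"
  shows "biproduct X A B S' (b \<cdot> i1) (b \<cdot> i2) (p1 \<cdot> b') (p2 \<cdot> b')"
proof -
  note D = assms(1)[unfolded biproduct_def]
  have c: "(p \<cdot> b') \<cdot> (b \<cdot> i) = p \<cdot> i" if "p \<in> Hom X S V" "i \<in> Hom X U S" for p i U V
  proof -
    have "(p \<cdot> b') \<cdot> (b \<cdot> i) = p \<cdot> (b' \<cdot> (b \<cdot> i))"
      by (rule Cmp_assoc[OF Cmp_Hom[OF that(2) b(1)] b(2) that(1)])
    also have "b' \<cdot> (b \<cdot> i) = i"
      using Cmp_assoc[OF that(2) b(1) b(2)] b(3) Cmp_Idn_left[OF that(2)] by simp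
    finally show ?thesis .
  qed
  have e: "(b \<cdot> i) \<cdot> (p \<cdot> b') = b \<cdot> (i \<cdot> p) \<cdot> b'" if "p \<in> Hom X S V" "i \<in> Hom X V S" for p i V
    using Cmp_assoc[OF Cmp_Hom[OF b(2) that(1)] that(2) b(1)] Cmp_assoc[OF b(2) that(1) that(2)]
      Cmp_assoc[OF b(2) Cmp_Hom[OF that] b(1)] by simp
  have i: "i1 \<in> Hom X A S" "i2 \<in> Hom X B S" "p1 \<in> Hom X S A" "p2 \<in> Hom X S B"
    using D by simp_all
  have "Hadd X ((b \<cdot> i1) \<cdot> (p1 \<cdot> b')) ((b \<cdot> i2) \<cdot> (p2 \<cdot> b'))
      = Hadd X (b \<cdot> (i1 \<cdot> p1)) (b \<cdot> (i2 \<cdot> p2)) \<cdot> b'"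
    unfolding e[OF i(3,1)] e[OF i(4,2)]
    by (rule Cmp_add_left[OF b(2) Cmp_Hom[OF Cmp_Hom[OF i(3,1)] b(1)]
        Cmp_Hom[OF Cmp_Hom[OF i(4,2)] b(1)], symmetric])
  also have "\<dots> = Idn X S'"
    using Cmp_add_right[OF Cmp_Hom[OF i(3,1)] Cmp_Hom[OF i(4,2)] b(1)] D
      Cmp_Idn_right[OF b(1)] b(4) by simp
  finally show ?thesis
    using D c[OF i(3,1)] c[OF i(3,2)] c[OF i(4,1)] c[OF i(4,2)] Cmp_Hom[OF i(1) b(1)]
      Cmp_Hom[OF i(2) b(1)] Cmp_Hom[OF b(2) i(3)] Cmp_Hom[OF b(2) i(4)]
    unfolding biproduct_def by simp
qed

end

section \<open>Additivity and functoriality of extension groups\<close>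

context ext_bifunctor
begin

lemma Ezero_Ext: "C \<in> Ob X \<Longrightarrow> A \<in> Ob X \<Longrightarrow> Ezero X C A \<in> Ext X C A"
  using comm_group.axioms(2)[OF ext_comm_group] group.is_monoid monoid.one_closed
  by (fastforce simp: ext_group_def)

lemma Eadd_Ext: "\<delta> \<in> Ext X C A \<Longrightarrow> \<epsilon> \<in> Ext X C A \<Longrightarrow> Eadd X \<delta> \<epsilon> \<in> Ext X C A"
  using comm_group.axioms(2)[OF ext_comm_group, of C A] Ext_Ob[of \<delta> C A]
    monoid.m_closed[of "ext_group X C A" \<delta> \<epsilon>] group.is_monoid
  by (fastforce simp: ext_group_def)

lemma Eadd_comm: "\<delta> \<in> Ext X C A \<Longrightarrow> \<epsilon> \<in> Ext X C A \<Longrightarrow> Eadd X \<delta> \<epsilon> = Eadd X \<epsilon> \<delta>"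
  using comm_group.axioms(1)[OF ext_comm_group, of C A] Ext_Ob[of \<delta> C A]
    comm_monoid.m_comm[of "ext_group X C A" \<delta> \<epsilon>]
  by (fastforce simp: ext_group_def)

lemma Eadd_Ezero_right: "\<delta> \<in> Ext X C A \<Longrightarrow> Eadd X \<delta> (Ezero X C A) = \<delta>"
  using comm_group.axioms(2)[OF ext_comm_group, of C A] Ext_Ob[of \<delta> C A]
    monoid.r_one[of "ext_group X C A" \<delta>] group.is_monoid
  by (fastforce simp: ext_group_def)

lemma Eadd_idem:
  assumes "\<delta> \<in> Ext X C A" "Eadd X \<delta> \<delta> = \<delta>" shows "\<delta> = Ezero X C A"
proof -
  interpret G: comm_group "ext_group X C A" using ext_comm_group Ext_Ob assms(1) by blast
  show ?thesis using assms G.l_cancel_one[of \<delta> \<delta>] by (simp add: ext_group_def)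
qed

lemma push_Ext:
  assumes "a \<in> Hom X A A'" "\<delta> \<in> Ext X C A" shows "push X a \<delta> \<in> Ext X C A'"
proof -
  have "push X a \<in> carrier (ext_group X C A) \<rightarrow> carrier (ext_group X C A')"
    using push_hom[OF assms(1)] Ext_Ob[OF assms(2)] unfolding hom_def by blast
  from funcset_mem[OF this, of \<delta>] show ?thesis using assms(2) by (simp add: ext_group_def)
qed

lemma pull_Ext:
  assumes "c \<in> Hom X C' C" "\<delta> \<in> Ext X C A" shows "pull X c \<delta> \<in> Ext X C' A"
proof -
  have "pull X c \<in> carrier (ext_group X C A) \<rightarrow> carrier (ext_group X C' A)"
    using pull_hom[OF assms(1)] Ext_Ob[OF assms(2)] unfolding hom_def by blast
  from funcset_mem[OF this, of \<delta>] show ?thesis using assms(2) by (simp add: ext_group_def)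
qed

lemma push_Eadd:
  "a \<in> Hom X A A' \<Longrightarrow> \<delta> \<in> Ext X C A \<Longrightarrow> \<epsilon> \<in> Ext X C A \<Longrightarrow>
    push X a (Eadd X \<delta> \<epsilon>) = Eadd X (push X a \<delta>) (push X a \<epsilon>)"
  using push_hom[of a A A' C] Ext_Ob[of \<delta> C A]
    hom_mult[of "push X a" "ext_group X C A" "ext_group X C A'" \<delta> \<epsilon>]
  by (simp add: ext_group_def)

lemma pull_Eadd:
  "c \<in> Hom X C' C \<Longrightarrow> \<delta> \<in> Ext X C A \<Longrightarrow> \<epsilon> \<in> Ext X C A \<Longrightarrow>
    pull X c (Eadd X \<delta> \<epsilon>) = Eadd X (pull X c \<delta>) (pull X c \<epsilon>)"
  using pull_hom[of c C' C A] Ext_Ob[of \<delta> C A]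
    hom_mult[of "pull X c" "ext_group X C A" "ext_group X C' A" \<delta> \<epsilon>]
  by (simp add: ext_group_def)

lemma push_Ezero:
  assumes "a \<in> Hom X A A'" "C \<in> Ob X" shows "push X a (Ezero X C A) = Ezero X C A'"
proof -
  have z: "Ezero X C A \<in> Ext X C A" using assms Hom_Ob Ezero_Ext by blast
  show ?thesis
    using Eadd_idem[OF push_Ext[OF assms(1) z]] push_Eadd[OF assms(1) z z] Eadd_Ezero_right[OF z]
    by simp
qed

lemma pull_Ezero:
  assumes "c \<in> Hom X C' C" "A \<in> Ob X" shows "pull X c (Ezero X C A) = Ezero X C' A"
proof -
  have z: "Ezero X C A \<in> Ext X C A" using assms Hom_Ob Ezero_Ext by blast
  show ?thesis
    using Eadd_idem[OF pull_Ext[OF assms(1) z]] pull_Eadd[OF assms(1) z z] Eadd_Ezero_right[OF z]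
    by simp
qed

lemma push_Hzero:
  assumes "\<delta> \<in> Ext X C A" "A' \<in> Ob X" shows "push X (Hzero X A A') \<delta> = Ezero X C A'"
proof -
  have z: "Hzero X A A' \<in> Hom X A A'" using assms Ext_Ob Hzero_Hom by blast
  show ?thesis
    using Eadd_idem[OF push_Ext[OF z assms(1)]] push_add[OF assms(1) z z] Hadd_Hzero_left[OF z]
    by simp
qed

lemma pull_Hzero:
  assumes "\<delta> \<in> Ext X C A" "C' \<in> Ob X" shows "pull X (Hzero X C' C) \<delta> = Ezero X C' A"
proof -
  have z: "Hzero X C' C \<in> Hom X C' C" using assms Ext_Ob Hzero_Hom by blast
  show ?thesis
    using Eadd_idem[OF pull_Ext[OF z assms(1)]] pull_add[OF assms(1) z z] Hadd_Hzero_left[OF z]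
    by simp
qed

end

section \<open>Exactness and pullbacks\<close>

context extriangulated_category
begin

lemma etriangle_Ob:
  assumes "etriangle X A B C x y \<delta>" shows "A \<in> Ob X" "B \<in> Ob X" "C \<in> Ob X"
  using assms Hom_Ob unfolding etriangle_def by blast+

lemma etriangle_zero:
  "biproduct X A C S i1 i2 p1 p2 \<Longrightarrow> etriangle X A S C i1 p2 (Ezero X C A)"
  using rlz_zero[of A C S i1 i2 p1 p2] biproduct_Ob[of A C S i1 i2 p1 p2] Ezero_Ext[of C A]
  unfolding etriangle_def by (simp add: biproduct_def)

lemma obtain_zero_object:
  obtains Z where "zero_object X Z" "Z \<in> Ob X"
  using ex_zero_object unfolding zero_object_def by blast

lemma obtain_biproduct:
  assumes "A \<in> Ob X" "B \<in> Ob X"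
  obtains S i1 i2 p1 p2 where "biproduct X A B S i1 i2 p1 p2"
  using ex_direct_sum[OF assms] unfolding direct_sum_of_def by blast

lemma etriangle_identity_left:
  assumes "zero_object X Z" "A \<in> Ob X"
  shows "etriangle X A A Z (Idn X A) (Hzero X A Z) (Ezero X Z A)"
  using etriangle_zero[OF biproduct_swap[OF biproduct_zero_object[OF assms]]] .

lemma etriangle_identity_right:
  assumes "zero_object X Z" "A \<in> Ob X"
  shows "etriangle X Z A A (Hzero X Z A) (Idn X A) (Ezero X A Z)"
  using etriangle_zero[OF biproduct_zero_object[OF assms]] .

lemma ex_realization:
  assumes "\<delta> \<in> Ext X C A" shows "\<exists>B x y. etriangle X A B C x y \<delta>"
proof -
  obtain B x y where xy: "x \<in> Hom X A B" "y \<in> Hom X B C" "rlz X \<delta> = seq_class X B x y"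
    using rlz_class[OF assms] by blast
  have "Idn X B \<in> Hom X B B" using Idn_Hom Hom_Ob[OF xy(1)] by blast
  moreover from this have "Idn X B \<cdot> Idn X B = Idn X B" by (rule Cmp_Idn_left)
  ultimately have "(x, y) \<in> seq_class X B x y"
    using Cmp_Idn_left[OF xy(1)] Cmp_Idn_right[OF xy(2)] unfolding seq_class_def by force
  thus ?thesis using xy assms unfolding etriangle_def by auto
qed

section \<open>Exact sequences attached to an E-triangle\<close>

text \<open>The split triangle \<open>Z -> B -> B\<close> maps to the given one by the identity in
  the middle and \<open>y\<close> at the right end, so \<open>pull X y \<delta>\<close> is a
  pushforward of a zero extension.\<close>

lemma pull_deflation:
  assumes "etriangle X A B C x y \<delta>" shows "pull X y \<delta> = Ezero X B A"
proof -
  obtain Z where Z: "zero_object X Z" by (rule obtain_zero_object)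
  have B: "B \<in> Ob X" and y: "y \<in> Hom X B C" using assms etriangle_Ob by (auto simp: etriangle_def)
  obtain a where "a \<in> Hom X Z A" "push X a (Ezero X B Z) = pull X y \<delta>"
    using ET3_op[OF etriangle_identity_right[OF Z B] assms Idn_Hom[OF B] y] by blast
  thus ?thesis using push_Ezero B by metis
qed

lemma push_inflation:
  assumes "etriangle X A B C x y \<delta>" shows "push X x \<delta> = Ezero X C B"
proof -
  obtain Z where Z: "zero_object X Z" by (rule obtain_zero_object)
  have B: "B \<in> Ob X" and x: "x \<in> Hom X A B" using assms etriangle_Ob by (auto simp: etriangle_def)
  obtain c where "c \<in> Hom X C Z" "push X x \<delta> = pull X c (Ezero X Z B)"
    using ET3[OF assms etriangle_identity_left[OF Z B] x Idn_Hom[OF B]] by blast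
  thus ?thesis using pull_Ezero B by metis
qed

text \<open>\<open>f \<cdot> x\<close> factors through a zero object, so ET3 applies with target the
  split triangle \<open>Z -> W -> W\<close>; its third component is the factorization.\<close>

lemma factor_through_cone:
  assumes t: "etriangle X A B C x y \<delta>" and f: "f \<in> Hom X B W" "f \<cdot> x = Hzero X A W"
  shows "\<exists>g\<in>Hom X C W. g \<cdot> y = f"
proof -
  obtain Z where Z: "zero_object X Z" "Z \<in> Ob X" by (rule obtain_zero_object)
  have W: "W \<in> Ob X" and A: "A \<in> Ob X" using f Hom_Ob etriangle_Ob[OF t] by auto
  have "f \<cdot> x = Hzero X Z W \<cdot> Hzero X A Z"
    using Cmp_Hzero_left[OF Hzero_Hom[OF A Z(2)] W] f(2) by simp
  from ET3[OF t etriangle_identity_right[OF Z(1) W] Hzero_Hom[OF A Z(2)] f(1) this]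
  show ?thesis using Cmp_Idn_left[OF f(1)] by auto
qed

text \<open>Since the pullback vanishes, the split triangle on \<open>A\<close> and \<open>W\<close>
  maps to the given one over \<open>f\<close>; the middle map restricted to the summand
  \<open>W\<close> is the lift.\<close>

lemma lift_to_middle:
  assumes t: "etriangle X A B C x y \<delta>" and f: "f \<in> Hom X W C" "pull X f \<delta> = Ezero X W A"
  shows "\<exists>g\<in>Hom X W B. y \<cdot> g = f"
proof -
  have W: "W \<in> Ob X" and A: "A \<in> Ob X" using f Hom_Ob etriangle_Ob[OF t] by auto
  obtain S i1 i2 p1 p2 where b: "biproduct X A W S i1 i2 p1 p2"
    using obtain_biproduct[OF A W] .
  have "push X (Idn X A) (Ezero X W A) = pull X f \<delta>"
    using f(2) push_Idn[OF Ezero_Ext[OF W A]] by simp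
  from rlz_morphism[OF etriangle_zero[OF b] t Idn_Hom[OF A] f(1) this]
  obtain g where g: "g \<in> Hom X S B" "y \<cdot> g = f \<cdot> p2" by blast
  have i: "i2 \<in> Hom X W S" "p2 \<in> Hom X S W" "p2 \<cdot> i2 = Idn X W" and y: "y \<in> Hom X B C"
    using b t by (auto simp: biproduct_def etriangle_def)
  have "y \<cdot> (g \<cdot> i2) = f"
    using Cmp_assoc[OF i(1) g(1) y] g(2) Cmp_assoc[OF i(1,2) f(1)] i(3) Cmp_Idn_right[OF f(1)] by simp
  thus ?thesis using Cmp_Hom[OF i(1) g(1)] by blast
qed

lemma extend_to_middle:
  assumes t: "etriangle X A B C x y \<delta>" and f: "f \<in> Hom X A W" "push X f \<delta> = Ezero X C W"
  shows "\<exists>g\<in>Hom X B W. g \<cdot> x = f"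
proof -
  have W: "W \<in> Ob X" and C: "C \<in> Ob X" using f Hom_Ob etriangle_Ob[OF t] by auto
  obtain S i1 i2 p1 p2 where b: "biproduct X W C S i1 i2 p1 p2"
    using obtain_biproduct[OF W C] .
  have "push X f \<delta> = pull X (Idn X C) (Ezero X C W)"
    using f(2) pull_Idn[OF Ezero_Ext[OF C W]] by simp
  from rlz_morphism[OF t etriangle_zero[OF b] f(1) Idn_Hom[OF C] this]
  obtain g where g: "g \<in> Hom X B S" "g \<cdot> x = i1 \<cdot> f" by blast
  have i: "i1 \<in> Hom X W S" "p1 \<in> Hom X S W" "p1 \<cdot> i1 = Idn X W" and x: "x \<in> Hom X A B"
    using b t by (auto simp: biproduct_def etriangle_def)
  have "(p1 \<cdot> g) \<cdot> x = f"
    using Cmp_assoc[OF x g(1) i(2)] g(2) Cmp_assoc[OF f(1) i(1,2)] i(3) Cmp_Idn_left[OF f(1)] by simp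
  thus ?thesis using Cmp_Hom[OF g(1) i(2)] by blast
qed

text \<open>Realize \<open>\<theta>\<close> by a triangle with middle term \<open>M\<close>. As
  \<open>push X x \<theta>\<close> vanishes, \<open>x\<close> extends to \<open>M\<close>, and ET3
  completes this extension to a map of triangles with third component \<open>f\<close>.\<close>

lemma Ext_exact_connecting_left:
  assumes t: "etriangle X A B C x y \<delta>" and "\<theta> \<in> Ext X W A" "push X x \<theta> = Ezero X W B"
  shows "\<exists>f\<in>Hom X W C. pull X f \<delta> = \<theta>"
proof -
  obtain M m e where m: "etriangle X A M W m e \<theta>" using ex_realization assms(2) by blast
  have A: "A \<in> Ob X" and x: "x \<in> Hom X A B" using t etriangle_Ob by (auto simp: etriangle_def)
  obtain g where g: "g \<in> Hom X M B" "g \<cdot> m = x" using extend_to_middle[OF m x assms(3)] by blast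
  from ET3[OF m t Idn_Hom[OF A] g(1)] show ?thesis
    using g(2) Cmp_Idn_right[OF x] push_Idn[OF assms(2)] by auto
qed

lemma Ext_exact_connecting_right:
  assumes t: "etriangle X A B C x y \<delta>" and "\<theta> \<in> Ext X C W" "pull X y \<theta> = Ezero X B W"
  shows "\<exists>f\<in>Hom X A W. push X f \<delta> = \<theta>"
proof -
  obtain M m e where m: "etriangle X W M C m e \<theta>" using ex_realization assms(2) by blast
  have C: "C \<in> Ob X" and y: "y \<in> Hom X B C" using t etriangle_Ob by (auto simp: etriangle_def)
  obtain g where g: "g \<in> Hom X B M" "e \<cdot> g = y" using lift_to_middle[OF m y assms(3)] by blast
  from ET3_op[OF t m g(1) Idn_Hom[OF C]] show ?thesis
    using g(2) Cmp_Idn_left[OF y] pull_Idn[OF assms(2)] by auto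
qed

lemma Ext_exact_middle_covariant:
  assumes t: "etriangle X A B C x y \<delta>" and th: "\<theta> \<in> Ext X W B" "push X y \<theta> = Ezero X W C"
  shows "\<exists>\<eta>\<in>Ext X W A. push X x \<eta> = \<theta>"
proof -
  have W: "W \<in> Ob X" using Ext_Ob th(1) by blast
  obtain M m e where m: "etriangle X B M W m e \<theta>" using ex_realization th(1) by blast
  \<comment> \<open>ET4 for \<open>x\<close> followed by \<open>m\<close>. The second triangle
    realizes \<open>push X y \<theta>\<close>, hence splits, and its section \<open>s\<close> pulls
    \<open>\<epsilon>\<close> back to a preimage of \<open>\<theta>\<close>.\<close>
  obtain E h d e' \<epsilon> where
    E: "etriangle X A M E (m \<cdot> x) h \<epsilon>" "etriangle X C E W d e' (push X y \<theta>)"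
      "push X x \<epsilon> = pull X e' \<theta>"
    using ET4[OF t m] by blast
  have h: "x \<in> Hom X A B" "e' \<in> Hom X E W" "\<epsilon> \<in> Ext X E A"
    using t E by (auto simp: etriangle_def)
  have "pull X (Idn X W) (push X y \<theta>) = Ezero X W C"
    using th pull_Idn E(2) unfolding etriangle_def by metis
  then obtain s where s: "s \<in> Hom X W E" "e' \<cdot> s = Idn X W"
    using lift_to_middle[OF E(2) Idn_Hom[OF W]] by blast
  have "push X x (pull X s \<epsilon>) = \<theta>"
    using push_pull[OF h(3,1) s(1)] E(3) pull_Cmp[OF th(1) h(2) s(1)] s(2) pull_Idn[OF th(1)]
    by simp
  thus ?thesis using pull_Ext[OF s(1) h(3)] by blast
qed

section \<open>Uniqueness of realizations and transport along isomorphisms\<close>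

lemma realizations_isomorphic:
  assumes "etriangle X A B C x y \<delta>" "etriangle X A B' C x' y' \<delta>"
  shows "\<exists>b b'. b \<in> Hom X B B' \<and> b' \<in> Hom X B' B \<and> b' \<cdot> b = Idn X B \<and> b \<cdot> b' = Idn X B' \<and>
    x' = b \<cdot> x \<and> y' = y \<cdot> b'"
proof -
  have d: "\<delta> \<in> Ext X C A" "(x, y) \<in> rlz X \<delta>" "(x', y') \<in> rlz X \<delta>"
    and h: "x \<in> Hom X A B" "y \<in> Hom X B C" "x' \<in> Hom X A B'" "y' \<in> Hom X B' C"
    using assms by (auto simp: etriangle_def)
  obtain B0 x0 y0 where r: "x0 \<in> Hom X A B0" "y0 \<in> Hom X B0 C" "rlz X \<delta> = seq_class X B0 x0 y0"
    using rlz_class[OF d(1)] by blast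
  have iso: "\<exists>b b'. b \<in> Hom X B0 B \<and> b' \<in> Hom X B B0 \<and> b' \<cdot> b = Idn X B0 \<and> b \<cdot> b' = Idn X B \<and>
    x = b \<cdot> x0 \<and> y = y0 \<cdot> b'" if xy: "x \<in> Hom X A B" "(x, y) \<in> rlz X \<delta>" for x y B
  proof -
    obtain B1 b b' where b: "b \<in> Hom X B0 B1" "b' \<in> Hom X B1 B0" "b' \<cdot> b = Idn X B0"
      "b \<cdot> b' = Idn X B1" "x = b \<cdot> x0" "y = y0 \<cdot> b'"
      using xy(2) r(3) unfolding seq_class_def by auto
    \<comment> \<open>The middle object in \<open>seq_class\<close> is only existentially given;
      disjointness of hom-sets identifies it.\<close>
    have "B1 = B" using Hom_disjoint xy(1) Cmp_Hom[OF r(1) b(1)] b(5) by blast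
    thus ?thesis using b by blast
  qed
  obtain b b' where b: "b \<in> Hom X B0 B" "b' \<in> Hom X B B0" "b' \<cdot> b = Idn X B0" "b \<cdot> b' = Idn X B"
    "x = b \<cdot> x0" "y = y0 \<cdot> b'" using iso[OF h(1) d(2)] by blast
  obtain c c' where c: "c \<in> Hom X B0 B'" "c' \<in> Hom X B' B0" "c' \<cdot> c = Idn X B0" "c \<cdot> c' = Idn X B'"
    "x' = c \<cdot> x0" "y' = y0 \<cdot> c'" using iso[OF h(3) d(3)] by blast
  have "(b \<cdot> c') \<cdot> (c \<cdot> b') = Idn X B"
    using Cmp_assoc[OF Cmp_Hom[OF b(2) c(1)] c(2) b(1)] Cmp_assoc[OF b(2) c(1) c(2)] c(3)
      Cmp_Idn_left[OF b(2)] b(4) by simp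
  moreover have "(c \<cdot> b') \<cdot> (b \<cdot> c') = Idn X B'"
    using Cmp_assoc[OF Cmp_Hom[OF c(2) b(1)] b(2) c(1)] Cmp_assoc[OF c(2) b(1) b(2)] b(3)
      Cmp_Idn_left[OF c(2)] c(4) by simp
  moreover have "x' = (c \<cdot> b') \<cdot> x"
    using Cmp_assoc[OF h(1) b(2) c(1)] Cmp_assoc[OF r(1) b(1,2)] b(3,5) Cmp_Idn_left[OF r(1)] c(5)
    by simp
  moreover have "y' = y \<cdot> (b \<cdot> c')"
    using Cmp_assoc[OF Cmp_Hom[OF c(2) b(1)] b(2) r(2)] Cmp_assoc[OF c(2) b(1) b(2)] b(3,6)
      Cmp_Idn_left[OF c(2)] c(6) by simp
  ultimately show ?thesis using Cmp_Hom[OF b(2) c(1)] Cmp_Hom[OF c(2) b(1)] by blast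
qed

lemma etriangle_iso_middle:
  assumes t: "etriangle X A B C x y \<delta>"
    and b: "b \<in> Hom X B B'" "b' \<in> Hom X B' B" "b' \<cdot> b = Idn X B" "b \<cdot> b' = Idn X B'"
  shows "etriangle X A B' C (b \<cdot> x) (y \<cdot> b') \<delta>"
proof -
  have d: "\<delta> \<in> Ext X C A" "(x, y) \<in> rlz X \<delta>" "x \<in> Hom X A B" "y \<in> Hom X B C"
    using t by (auto simp: etriangle_def)
  obtain B0 x0 y0 where r: "x0 \<in> Hom X A B0" "y0 \<in> Hom X B0 C" "rlz X \<delta> = seq_class X B0 x0 y0"
    using rlz_class[OF d(1)] by blast
  obtain B1 c c' where c: "c \<in> Hom X B0 B1" "c' \<in> Hom X B1 B0" "c' \<cdot> c = Idn X B0"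
    "c \<cdot> c' = Idn X B1" "x = c \<cdot> x0" "y = y0 \<cdot> c'"
    using d(2) r(3) unfolding seq_class_def by auto
  have B1: "B1 = B" using Hom_disjoint d(3) Cmp_Hom[OF r(1) c(1)] c(5) by blast
  note c = c[unfolded B1]
  have "(c' \<cdot> b') \<cdot> (b \<cdot> c) = Idn X B0"
    using Cmp_assoc[OF Cmp_Hom[OF c(1) b(1)] b(2) c(2)] Cmp_assoc[OF c(1) b(1) b(2)] b(3)
      Cmp_Idn_left[OF c(1)] c(3) by simp
  moreover have "(b \<cdot> c) \<cdot> (c' \<cdot> b') = Idn X B'"
    using Cmp_assoc[OF Cmp_Hom[OF b(2) c(2)] c(1) b(1)] Cmp_assoc[OF b(2) c(2) c(1)] c(4)
      Cmp_Idn_left[OF b(2)] b(4) by simp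
  moreover have "b \<cdot> x = (b \<cdot> c) \<cdot> x0" using Cmp_assoc[OF r(1) c(1) b(1)] c(5) by simp
  moreover have "y \<cdot> b' = y0 \<cdot> (c' \<cdot> b')" using Cmp_assoc[OF b(2) c(2) r(2)] c(6) by simp
  ultimately have "(b \<cdot> x, y \<cdot> b') \<in> rlz X \<delta>"
    unfolding r(3) seq_class_def using Cmp_Hom[OF c(1) b(1)] Cmp_Hom[OF b(2) c(2)] by blast
  thus ?thesis using d Cmp_Hom[OF d(3) b(1)] Cmp_Hom[OF b(2) d(4)] unfolding etriangle_def by blast
qed

text \<open>If \<open>w\<close> fixes both maps of the triangle then \<open>w = 1 + u\<close> with \<open>u = v y\<close> and \<open>y u = 0\<close>, so
  \<open>u\<^sup>2 = 0\<close>.\<close>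

lemma middle_endo_invertible:
  assumes t: "etriangle X A B C x y \<delta>" and w: "w \<in> Hom X B B" "w \<cdot> x = x" "y \<cdot> w = y"
  shows "\<exists>w'\<in>Hom X B B. w \<cdot> w' = Idn X B \<and> w' \<cdot> w = Idn X B"
proof -
  have h: "x \<in> Hom X A B" "y \<in> Hom X B C" using t by (auto simp: etriangle_def)
  have o: "A \<in> Ob X" "B \<in> Ob X" "C \<in> Ob X" by (rule etriangle_Ob[OF t])+
  note I = Idn_Hom[OF o(2)]
  obtain m where m: "m \<in> Hom X B B" "Hadd X m (Idn X B) = Hzero X B B" using ex_Hneg[OF I] by blast
  have m2: "Hadd X (Idn X B) m = Hzero X B B" using m Hadd_comm[OF I m(1)] by simp
  define u where "u = Hadd X w m"
  have u: "u \<in> Hom X B B" using Hadd_Hom w(1) m(1) u_def by blast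
  have wu: "w = Hadd X (Idn X B) u"
    unfolding u_def using Hadd_comm[OF w(1) m(1)] Hadd_assoc[OF I m(1) w(1)] m2
      Hadd_Hzero_left[OF w(1)] by simp
  have "u \<cdot> x = Hadd X (Idn X B \<cdot> x) (m \<cdot> x)"
    unfolding u_def using Cmp_add_left[OF h(1) w(1) m(1)] w(2) Cmp_Idn_left[OF h(1)] by simp
  also have "\<dots> = Hzero X A B"
    using Cmp_add_left[OF h(1) I m(1)] m2 Cmp_Hzero_left[OF h(1) o(2)] by simp
  finally obtain v where v: "v \<in> Hom X C B" "v \<cdot> y = u" using factor_through_cone[OF t u] by blast
  have "y \<cdot> u = Hadd X (y \<cdot> Idn X B) (y \<cdot> m)"
    unfolding u_def using Cmp_add_right[OF w(1) m(1) h(2)] w(3) Cmp_Idn_right[OF h(2)] by simp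
  also have "\<dots> = Hzero X B C"
    using Cmp_add_right[OF I m(1) h(2)] m2 Cmp_Hzero_right[OF h(2) o(2)] by simp
  finally have uu: "u \<cdot> u = Hzero X B B"
    using Cmp_assoc[OF u h(2) v(1)] v(2) Cmp_Hzero_right[OF v(1) o(2)] by simp
  obtain u' where u': "u' \<in> Hom X B B" "Hadd X u' u = Hzero X B B" using ex_Hneg[OF u] by blast
  have u'2: "Hadd X u u' = Hzero X B B" using u' Hadd_comm[OF u u'(1)] by simp
  have z: "u \<cdot> u' = Hzero X B B" "u' \<cdot> u = Hzero X B B"
    using Cmp_add_right[OF u u'(1) u] u'2 uu Cmp_Hzero_right[OF u o(2)]
      Cmp_add_left[OF u u u'(1)] Cmp_Hzero_left[OF u o(2)]
      Hadd_Hzero_left[OF Cmp_Hom[OF u u'(1)]] Hadd_Hzero_left[OF Cmp_Hom[OF u'(1) u]]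
      Hadd_Hzero_left[OF Cmp_Hom[OF u u'(1)]] by simp_all
  define w' where "w' = Hadd X (Idn X B) u'"
  have w': "w' \<in> Hom X B B" using Hadd_Hom[OF I u'(1)] w'_def by simp
  have "w \<cdot> w' = Idn X B"
    using Cmp_add_left[OF w' I u] wu Cmp_Idn_left[OF w'] Cmp_add_right[OF I u'(1) u] w'_def
      Cmp_Idn_right[OF u] z(1) Hadd_Hzero_right[OF u] Hadd_assoc[OF I u'(1) u] u'(2)
      Hadd_Hzero_right[OF I] by simp
  moreover have "w' \<cdot> w = Idn X B"
    using Cmp_add_left[OF w(1) I u'(1)] wu Cmp_Idn_left[OF w(1)] Cmp_add_right[OF I u u'(1)] w'_def
      Cmp_Idn_right[OF u'(1)] z(2) Hadd_Hzero_right[OF u'(1)] Hadd_assoc[OF I u u'(1)] u'2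
      Hadd_Hzero_right[OF I] by simp
  ultimately show ?thesis using w' by blast
qed

lemma invertible_of_both_composites:
  assumes b: "b \<in> Hom X B B'" "c \<in> Hom X B' B"
    and u: "u \<in> Hom X B B" "(c \<cdot> b) \<cdot> u = Idn X B" "u \<cdot> (c \<cdot> b) = Idn X B"
    and v: "v \<in> Hom X B' B'" "(b \<cdot> c) \<cdot> v = Idn X B'"
  shows "\<exists>b'\<in>Hom X B' B. b' \<cdot> b = Idn X B \<and> b \<cdot> b' = Idn X B'"
proof -
  have 1: "(u \<cdot> c) \<cdot> b = Idn X B" using Cmp_assoc[OF b u(1)] u by simp
  have 2: "b \<cdot> (c \<cdot> v) = Idn X B'" using Cmp_assoc[OF v(1) b(2,1)] v by simp
  have "u \<cdot> c = (u \<cdot> c) \<cdot> (b \<cdot> (c \<cdot> v))" using 2 Cmp_Idn_right[OF Cmp_Hom[OF b(2) u(1)]] by simp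
  also have "\<dots> = c \<cdot> v"
    using Cmp_assoc[OF Cmp_Hom[OF v(1) b(2)] b(1) Cmp_Hom[OF b(2) u(1)]] 1
      Cmp_Idn_left[OF Cmp_Hom[OF v(1) b(2)]] by simp
  finally show ?thesis using 1 2 Cmp_Hom[OF b(2) u(1)] by metis
qed

lemma middle_map_invertible:
  assumes t: "etriangle X A B C x y \<delta>" "etriangle X A' B' C' x' y' \<delta>'"
    and b: "b \<in> Hom X B B'" "c \<in> Hom X B' B"
    and "(c \<cdot> b) \<cdot> x = x" "y \<cdot> (c \<cdot> b) = y" "(b \<cdot> c) \<cdot> x' = x'" "y' \<cdot> (b \<cdot> c) = y'"
  shows "\<exists>b'\<in>Hom X B' B. b' \<cdot> b = Idn X B \<and> b \<cdot> b' = Idn X B'"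
  using middle_endo_invertible[OF t(1) Cmp_Hom[OF b]] middle_endo_invertible[OF t(2) Cmp_Hom[OF b(2,1)]]
    invertible_of_both_composites[OF b] assms(5-8) by blast

text \<open>A realization of \<open>pull X c' \<delta>\<close> is compared with the given triangle
  in both directions. The two composites on middle terms fix the maps of the triangles, so they are
  invertible, and the given middle term can replace the realized one.\<close>

lemma etriangle_iso_right:
  assumes t: "etriangle X A B C x y \<delta>"
    and c: "c \<in> Hom X C C'" "c' \<in> Hom X C' C" "c' \<cdot> c = Idn X C" "c \<cdot> c' = Idn X C'"
  shows "etriangle X A B C' x (c \<cdot> y) (pull X c' \<delta>)"
proof -
  have h: "x \<in> Hom X A B" "y \<in> Hom X B C" "\<delta> \<in> Ext X C A" using t by (auto simp: etriangle_def)
  have o: "A \<in> Ob X" "B \<in> Ob X" "C \<in> Ob X" by (rule etriangle_Ob[OF t])+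
  obtain B' x' y' where t': "etriangle X A B' C' x' y' (pull X c' \<delta>)"
    using ex_realization[OF pull_Ext[OF c(2) h(3)]] by blast
  have h': "x' \<in> Hom X A B'" "y' \<in> Hom X B' C'" "pull X c' \<delta> \<in> Ext X C' A"
    using t' by (auto simp: etriangle_def)
  obtain b where b: "b \<in> Hom X B' B" "b \<cdot> x' = x" "y \<cdot> b = c' \<cdot> y'"
    using rlz_morphism[OF t' t Idn_Hom[OF o(1)] c(2) push_Idn[OF h'(3)]] Cmp_Idn_right[OF h(1)]
    by auto
  have "push X (Idn X A) \<delta> = pull X c (pull X c' \<delta>)"
    using push_Idn[OF h(3)] pull_Cmp[OF h(3) c(2,1)] c(3) pull_Idn[OF h(3)] by simp
  then obtain d where d: "d \<in> Hom X B B'" "d \<cdot> x = x'" "y' \<cdot> d = c \<cdot> y"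
    using rlz_morphism[OF t t' Idn_Hom[OF o(1)] c(1)] Cmp_Idn_right[OF h'(1)] by auto
  have "y \<cdot> (b \<cdot> d) = y"
    using Cmp_assoc[OF d(1) b(1) h(2)] b(3) Cmp_assoc[OF d(1) h'(2) c(2)] d(3)
      Cmp_assoc[OF h(2) c(1,2)] c(3) Cmp_Idn_left[OF h(2)] by simp
  moreover have "y' \<cdot> (d \<cdot> b) = y'"
    using Cmp_assoc[OF b(1) d(1) h'(2)] d(3) Cmp_assoc[OF b(1) h(2) c(1)] b(3)
      Cmp_assoc[OF h'(2) c(2,1)] c(4) Cmp_Idn_left[OF h'(2)] by simp
  ultimately obtain b' where b': "b' \<in> Hom X B B'" "b' \<cdot> b = Idn X B'" "b \<cdot> b' = Idn X B"
    using middle_map_invertible[OF t' t b(1) d(1)] Cmp_assoc[OF h(1) d(1) b(1)]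
      Cmp_assoc[OF h'(1) b(1) d(1)] b(2) d(2) by auto
  have "y' \<cdot> b' = c \<cdot> (c' \<cdot> y') \<cdot> b'"
    using Cmp_assoc[OF h'(2) c(2,1)] c(4) Cmp_Idn_left[OF h'(2)] by simp
  also have "\<dots> = c \<cdot> (y \<cdot> b \<cdot> b')"
    using b(3) Cmp_assoc[OF b'(1) Cmp_Hom[OF b(1) h(2)] c(1)] by simp
  also have "\<dots> = c \<cdot> y" using Cmp_assoc[OF b'(1) b(1) h(2)] b'(3) Cmp_Idn_right[OF h(2)] by simp
  finally show ?thesis using etriangle_iso_middle[OF t' b(1) b'] b(2) by simp
qed

lemma etriangle_iso_left:
  assumes t: "etriangle X A B C x y \<delta>"
    and a: "a \<in> Hom X A A'" "a' \<in> Hom X A' A" "a' \<cdot> a = Idn X A" "a \<cdot> a' = Idn X A'"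
  shows "etriangle X A' B C (x \<cdot> a') y (push X a \<delta>)"
proof -
  have h: "x \<in> Hom X A B" "y \<in> Hom X B C" "\<delta> \<in> Ext X C A" using t by (auto simp: etriangle_def)
  have o: "A \<in> Ob X" "B \<in> Ob X" "C \<in> Ob X" by (rule etriangle_Ob[OF t])+
  obtain B' x' y' where t': "etriangle X A' B' C x' y' (push X a \<delta>)"
    using ex_realization[OF push_Ext[OF a(1) h(3)]] by blast
  have h': "x' \<in> Hom X A' B'" "y' \<in> Hom X B' C" "push X a \<delta> \<in> Ext X C A'"
    using t' by (auto simp: etriangle_def)
  obtain b where b: "b \<in> Hom X B B'" "b \<cdot> x = x' \<cdot> a" "y' \<cdot> b = y"
    using rlz_morphism[OF t t' a(1) Idn_Hom[OF o(3)] pull_Idn[OF h'(3), symmetric]]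
      Cmp_Idn_left[OF h(2)] by auto
  have "push X a' (push X a \<delta>) = pull X (Idn X C) \<delta>"
    using pull_Idn[OF h(3)] push_Cmp[OF h(3) a(1,2)] a(3) push_Idn[OF h(3)] by simp
  then obtain d where d: "d \<in> Hom X B' B" "d \<cdot> x' = x \<cdot> a'" "y \<cdot> d = y'"
    using rlz_morphism[OF t' t a(2) Idn_Hom[OF o(3)]] Cmp_Idn_left[OF h'(2)] by auto
  have "(d \<cdot> b) \<cdot> x = x"
    using Cmp_assoc[OF h(1) b(1) d(1)] b(2) Cmp_assoc[OF a(1) h'(1) d(1)] d(2)
      Cmp_assoc[OF a(1,2) h(1)] a(3) Cmp_Idn_right[OF h(1)] by simp
  moreover have "(b \<cdot> d) \<cdot> x' = x'"
    using Cmp_assoc[OF h'(1) d(1) b(1)] d(2) Cmp_assoc[OF a(2) h(1) b(1)] b(2)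
      Cmp_assoc[OF a(2,1) h'(1)] a(4) Cmp_Idn_right[OF h'(1)] by simp
  ultimately obtain b' where b': "b' \<in> Hom X B' B" "b' \<cdot> b = Idn X B" "b \<cdot> b' = Idn X B'"
    using middle_map_invertible[OF t t' b(1) d(1)] Cmp_assoc[OF b(1) d(1) h(2)]
      Cmp_assoc[OF d(1) b(1) h'(2)] b(3) d(3) by auto
  have "b' \<cdot> x' = b' \<cdot> ((x' \<cdot> a) \<cdot> a')"
    using Cmp_assoc[OF a(2,1) h'(1)] a(4) Cmp_Idn_right[OF h'(1)] by simp
  also have "\<dots> = x \<cdot> a'"
    using b(2) Cmp_assoc[OF a(2) h(1) b(1)] Cmp_assoc[OF Cmp_Hom[OF a(2) h(1)] b(1) b'(1)] b'(2)
      Cmp_Idn_left[OF Cmp_Hom[OF a(2) h(1)]] by simp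
  finally show ?thesis using etriangle_iso_middle[OF t' b'(1) b(1) b'(3,2)] b(3) by simp
qed

section \<open>Triangles on objects: composition, pullback and pushout\<close>

abbreviation tri :: "'a \<Rightarrow> 'a \<Rightarrow> 'a \<Rightarrow> bool" where
  "tri \<equiv> is_etriangle X"

lemma tri_Ob:
  assumes "tri A B C" shows "A \<in> Ob X" "B \<in> Ob X" "C \<in> Ob X"
  using assms etriangle_Ob unfolding is_etriangle_def by blast+

lemma tri_identity_left: "zero_object X Z \<Longrightarrow> A \<in> Ob X \<Longrightarrow> tri A A Z"
  using etriangle_identity_left unfolding is_etriangle_def by blast

lemma tri_identity_right: "zero_object X Z \<Longrightarrow> A \<in> Ob X \<Longrightarrow> tri Z A A"
  using etriangle_identity_right unfolding is_etriangle_def by blast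

lemma inflation_comp: "tri A B D \<Longrightarrow> tri B C F \<Longrightarrow> \<exists>E. tri A C E \<and> tri D E F"
  unfolding is_etriangle_def using ET4 by metis

lemma deflation_comp: "tri D B A \<Longrightarrow> tri F C B \<Longrightarrow> \<exists>E. tri E C A \<and> tri F E D"
  unfolding is_etriangle_def using ET4_op by metis

text \<open>\<open>M\<close> realizes the class with components \<open>\<delta>1\<close> and
  \<open>\<delta>2\<close>. Applied to \<open>A2 -> S -> M\<close>, ET4 yields a cone that realizes
  the projected class \<open>\<delta>1\<close>, so this cone is isomorphic to
  \<open>B1\<close>.\<close>

lemma pullback_of_biproduct:
  assumes t: "etriangle X A1 B1 C x1 y1 \<delta>1" and d: "\<delta>2 \<in> Ext X C A2"
    and bp: "biproduct X A1 A2 S i1 i2 p1 p2"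
    and m: "etriangle X S M C m e (Eadd X (push X i1 \<delta>1) (push X i2 \<delta>2))"
  shows "tri A2 M B1"
proof -
  have h: "i1 \<in> Hom X A1 S" "i2 \<in> Hom X A2 S" "p1 \<in> Hom X S A1" "\<delta>1 \<in> Ext X C A1"
    "p1 \<cdot> i1 = Idn X A1" "p1 \<cdot> i2 = Hzero X A2 A1"
    using bp t by (auto simp: biproduct_def etriangle_def)
  have "push X p1 (Eadd X (push X i1 \<delta>1) (push X i2 \<delta>2)) = Eadd X \<delta>1 (Ezero X C A1)"
    using push_Eadd[OF h(3) push_Ext[OF h(1,4)] push_Ext[OF h(2) d]]
      push_Cmp[OF h(4,1,3)] push_Cmp[OF d h(2,3)] h(5,6) push_Idn[OF h(4)]
      push_Hzero[OF d biproduct_Ob(1)[OF bp]] by simp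
  hence p: "push X p1 (Eadd X (push X i1 \<delta>1) (push X i2 \<delta>2)) = \<delta>1"
    using Eadd_Ezero_right[OF h(4)] by simp
  obtain E k c c' \<epsilon> where E: "etriangle X A2 M E (m \<cdot> i2) k \<epsilon>" "etriangle X A1 E C c c' \<delta>1"
    using ET4[OF etriangle_zero[OF biproduct_swap[OF bp]] m] p by metis
  show ?thesis
    using realizations_isomorphic[OF E(2) t] etriangle_iso_right[OF E(1)]
    unfolding is_etriangle_def by blast
qed

lemma pullback:
  assumes "tri A1 B1 C" "tri A2 B2 C"
  shows "\<exists>M. tri A1 M B2 \<and> tri A2 M B1"
proof -
  obtain x1 y1 \<delta>1 x2 y2 \<delta>2 where
    t: "etriangle X A1 B1 C x1 y1 \<delta>1" "etriangle X A2 B2 C x2 y2 \<delta>2"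
    using assms unfolding is_etriangle_def by blast
  have d: "\<delta>1 \<in> Ext X C A1" "\<delta>2 \<in> Ext X C A2" using t by (auto simp: etriangle_def)
  obtain S i1 i2 p1 p2 where bp: "biproduct X A1 A2 S i1 i2 p1 p2"
    using obtain_biproduct[OF etriangle_Ob(1)[OF t(1)] etriangle_Ob(1)[OF t(2)]] .
  have e: "push X i1 \<delta>1 \<in> Ext X C S" "push X i2 \<delta>2 \<in> Ext X C S"
    using bp d push_Ext unfolding biproduct_def by blast+
  obtain M m e where m: "etriangle X S M C m e (Eadd X (push X i1 \<delta>1) (push X i2 \<delta>2))"
    using ex_realization[OF Eadd_Ext[OF e]] by blast
  show ?thesis
    using pullback_of_biproduct[OF t(1) d(2) bp m]
      pullback_of_biproduct[OF t(2) d(1) biproduct_swap[OF bp] m[unfolded Eadd_comm[OF e]]]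
    by blast
qed

text \<open>Dually, ET4_op applied to \<open>M -> S -> C2\<close> yields a cocone that realizes the
  restricted class \<open>\<delta>1\<close>, so this cocone is isomorphic to
  \<open>B1\<close>.\<close>

lemma pushout_of_biproduct:
  assumes t: "etriangle X A B1 C1 x1 y1 \<delta>1" and d: "\<delta>2 \<in> Ext X C2 A"
    and bp: "biproduct X C1 C2 S i1 i2 p1 p2"
    and m: "etriangle X A M S m e (Eadd X (pull X p1 \<delta>1) (pull X p2 \<delta>2))"
  shows "tri B1 M C2"
proof -
  have h: "p1 \<in> Hom X S C1" "p2 \<in> Hom X S C2" "i1 \<in> Hom X C1 S" "\<delta>1 \<in> Ext X C1 A"
    "p1 \<cdot> i1 = Idn X C1" "p2 \<cdot> i1 = Hzero X C1 C2"
    using bp t by (auto simp: biproduct_def etriangle_def)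
  have "pull X i1 (Eadd X (pull X p1 \<delta>1) (pull X p2 \<delta>2)) = Eadd X \<delta>1 (Ezero X C1 A)"
    using pull_Eadd[OF h(3) pull_Ext[OF h(1,4)] pull_Ext[OF h(2) d]]
      pull_Cmp[OF h(4,1,3)] pull_Cmp[OF d h(2,3)] h(5,6) pull_Idn[OF h(4)]
      pull_Hzero[OF d biproduct_Ob(1)[OF bp]] by simp
  hence p: "pull X i1 (Eadd X (pull X p1 \<delta>1) (pull X p2 \<delta>2)) = \<delta>1"
    using Eadd_Ezero_right[OF h(4)] by simp
  obtain E k c c' \<epsilon> where E: "etriangle X E M C2 k (p2 \<cdot> e) \<epsilon>" "etriangle X A E C1 c c' \<delta>1"
    using ET4_op[OF etriangle_zero[OF bp] m] p by metis
  show ?thesis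
    using realizations_isomorphic[OF E(2) t] etriangle_iso_left[OF E(1)]
    unfolding is_etriangle_def by blast
qed

lemma pushout:
  assumes "tri A B1 C1" "tri A B2 C2"
  shows "\<exists>M. tri B1 M C2 \<and> tri B2 M C1"
proof -
  obtain x1 y1 \<delta>1 x2 y2 \<delta>2 where
    t: "etriangle X A B1 C1 x1 y1 \<delta>1" "etriangle X A B2 C2 x2 y2 \<delta>2"
    using assms unfolding is_etriangle_def by blast
  have d: "\<delta>1 \<in> Ext X C1 A" "\<delta>2 \<in> Ext X C2 A" using t by (auto simp: etriangle_def)
  obtain S i1 i2 p1 p2 where bp: "biproduct X C1 C2 S i1 i2 p1 p2"
    using obtain_biproduct[OF etriangle_Ob(3)[OF t(1)] etriangle_Ob(3)[OF t(2)]] .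
  have e: "pull X p1 \<delta>1 \<in> Ext X S A" "pull X p2 \<delta>2 \<in> Ext X S A"
    using bp d pull_Ext unfolding biproduct_def by blast+
  obtain M m e where m: "etriangle X A M S m e (Eadd X (pull X p1 \<delta>1) (pull X p2 \<delta>2))"
    using ex_realization[OF Eadd_Ext[OF e]] by blast
  show ?thesis
    using pushout_of_biproduct[OF t(1) d(2) bp m]
      pushout_of_biproduct[OF t(2) d(1) biproduct_swap[OF bp] m[unfolded Eadd_comm[OF e]]]
    by blast
qed

section \<open>Vanishing of extensions and splitting\<close>

text \<open>Requiring equality with a singleton, not mere inclusion, forces \<open>C\<close> and
  \<open>A\<close> to be objects.\<close>

definition van :: "'a \<Rightarrow> 'a \<Rightarrow> bool" where
  "van C A \<longleftrightarrow> Ext X C A = {Ezero X C A}"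

lemma vanI:
  "C \<in> Ob X \<Longrightarrow> A \<in> Ob X \<Longrightarrow> (\<And>\<theta>. \<theta> \<in> Ext X C A \<Longrightarrow> \<theta> = Ezero X C A) \<Longrightarrow> van C A"
  unfolding van_def using Ezero_Ext by blast

lemma vanD: "van C A \<Longrightarrow> \<theta> \<in> Ext X C A \<Longrightarrow> \<theta> = Ezero X C A"
  unfolding van_def by blast

lemma van_Ob:
  assumes "van C A" shows "C \<in> Ob X" "A \<in> Ob X"
  using assms Ext_Ob[of "Ezero X C A" C A] unfolding van_def by auto

lemma van_split:
  assumes "tri A B C" "van C A" shows "direct_sum_of X B A C"
proof -
  obtain x y \<delta> where t: "etriangle X A B C x y \<delta>" using assms(1) unfolding is_etriangle_def by blast
  have d: "\<delta> = Ezero X C A" using vanD[OF assms(2)] t unfolding etriangle_def by blast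
  obtain S i1 i2 p1 p2 where bp: "biproduct X A C S i1 i2 p1 p2"
    using obtain_biproduct[OF etriangle_Ob(1)[OF t] etriangle_Ob(3)[OF t]] .
  show ?thesis
    using realizations_isomorphic[OF etriangle_zero[OF bp] t[unfolded d]] biproduct_iso[OF bp]
    unfolding direct_sum_of_def by blast
qed

lemma direct_sum_tri: "direct_sum_of X B A C \<Longrightarrow> tri A B C"
  unfolding direct_sum_of_def is_etriangle_def using etriangle_zero by blast

text \<open>A split triangle can be read in either order. This reorients the output of a pullback or
  pushout for the next construction.\<close>

lemma van_swap: "tri A B C \<Longrightarrow> van C A \<Longrightarrow> tri C B A"
  using van_split direct_sum_of_swap direct_sum_tri by blast

lemma van_summand:
  assumes "direct_sum_of X S A B" "van S Y" shows "van A Y"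
proof -
  obtain i p where h: "i \<in> Hom X A S" "p \<in> Hom X S A" "p \<cdot> i = Idn X A"
    using assms(1) unfolding direct_sum_of_def biproduct_def by blast
  show ?thesis
  proof (rule vanI)
    show "A \<in> Ob X" "Y \<in> Ob X" using h Hom_Ob van_Ob[OF assms(2)] by blast+
    fix \<theta> assume th: "\<theta> \<in> Ext X A Y"
    have "pull X p \<theta> = Ezero X S Y" using vanD[OF assms(2) pull_Ext[OF h(2) th]] .
    thus "\<theta> = Ezero X A Y"
      using pull_Cmp[OF th h(2,1)] h(3) pull_Idn[OF th] pull_Ezero[OF h(1) \<open>Y \<in> Ob X\<close>] by simp
  qed
qed

lemma van_middle_covariant:
  assumes "tri A B C" "van W A" "van W C" shows "van W B"
proof -
  obtain x y \<delta> where t: "etriangle X A B C x y \<delta>" using assms(1) unfolding is_etriangle_def by blast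
  have h: "x \<in> Hom X A B" "y \<in> Hom X B C" using t by (auto simp: etriangle_def)
  have W: "W \<in> Ob X" using van_Ob[OF assms(2)] by simp
  show ?thesis
  proof (rule vanI[OF W etriangle_Ob(2)[OF t]])
    fix \<theta> assume th: "\<theta> \<in> Ext X W B"
    then obtain \<eta> where "\<eta> \<in> Ext X W A" "push X x \<eta> = \<theta>"
      using Ext_exact_middle_covariant[OF t th vanD[OF assms(3) push_Ext[OF h(2) th]]] by blast
    thus "\<theta> = Ezero X W B" using vanD[OF assms(2)] push_Ezero[OF h(1) W] by metis
  qed
qed

text \<open>As extensions of \<open>V\<close> by \<open>W\<close> vanish, each class in
  \<open>E(V, K)\<close> is \<open>pull X f \<delta>\<close> for some \<open>f\<close>; this
  \<open>f\<close> factors through the approximation \<open>g\<close>, and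
  \<open>pull X g \<delta>\<close> is zero.\<close>

lemma van_approximation_cocone:
  assumes t: "etriangle X K W C k g \<delta>" and a: "right_approximation X \<omega> W C g"
    and V: "V \<in> \<omega>" "van V W"
  shows "van V K"
proof (rule vanI[OF van_Ob(1)[OF V(2)] etriangle_Ob(1)[OF t]])
  have h: "k \<in> Hom X K W" "g \<in> Hom X W C" "\<delta> \<in> Ext X C K" using t by (auto simp: etriangle_def)
  fix \<theta> assume th: "\<theta> \<in> Ext X V K"
  obtain f where f: "f \<in> Hom X V C" "pull X f \<delta> = \<theta>"
    using Ext_exact_connecting_left[OF t th vanD[OF V(2) push_Ext[OF h(1) th]]] by blast
  obtain f' where f': "f' \<in> Hom X V W" "g \<cdot> f' = f"
    using a V(1) f(1) unfolding right_approximation_def by blast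
  show "\<theta> = Ezero X V K"
    using pull_Cmp[OF h(3,2) f'(1)] f'(2) f(2) pull_deflation[OF t]
      pull_Ezero[OF f'(1) etriangle_Ob(1)[OF t]] by simp
qed

section \<open>Dimension shifting\<close>

lemma projective_van:
  assumes "projective X P" "A \<in> Ob X" shows "van P A"
proof (rule vanI)
  show P: "P \<in> Ob X" using assms(1) by (simp add: projective_def)
  show "A \<in> Ob X" by fact
  fix \<theta> assume th: "\<theta> \<in> Ext X P A"
  obtain M x y where t: "etriangle X A M P x y \<theta>" using ex_realization[OF th] by blast
  have y: "y \<in> Hom X M P" using t by (simp add: etriangle_def)
  obtain s where s: "s \<in> Hom X P M" "y \<cdot> s = Idn X P"
    using assms(1) t Idn_Hom[OF P] unfolding projective_def by blast
  show "\<theta> = Ezero X P A"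
    using pull_Cmp[OF th y s(1)] s(2) pull_Idn[OF th] pull_deflation[OF t]
      pull_Ezero[OF s(1) assms(2)] by simp
qed

lemma injective_van:
  assumes "injective X I" "C \<in> Ob X" shows "van C I"
proof (rule vanI)
  show I: "I \<in> Ob X" using assms(1) by (simp add: injective_def)
  show "C \<in> Ob X" by fact
  fix \<theta> assume th: "\<theta> \<in> Ext X C I"
  obtain M x y where t: "etriangle X I M C x y \<theta>" using ex_realization[OF th] by blast
  have x: "x \<in> Hom X I M" using t by (simp add: etriangle_def)
  obtain s where s: "s \<in> Hom X M I" "s \<cdot> x = Idn X I"
    using assms(1) t Idn_Hom[OF I] unfolding injective_def by blast
  show "\<theta> = Ezero X C I"
    using push_Cmp[OF th x s(1)] s(2) push_Idn[OF th] push_inflation[OF t]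
      push_Ezero[OF s(1) assms(2)] by simp
qed

text \<open>In the next five lemmas \<open>L \<rightarrow> P \<rightarrow> V\<close> exhibits \<open>L\<close> as a syzygy of \<open>V\<close> and
  \<open>Y \<rightarrow> I \<rightarrow> S\<close> exhibits \<open>S\<close> as a cosyzygy of \<open>Y\<close>.\<close>

lemma van_syzygy_iff:
  assumes "projective X P" "tri L P V" "injective X I" "tri Y I S"
  shows "van L Y \<longleftrightarrow> van V S"
proof -
  obtain k p \<rho> where r: "etriangle X L P V k p \<rho>" using assms(2) unfolding is_etriangle_def by blast
  obtain x y \<delta> where t: "etriangle X Y I S x y \<delta>" using assms(4) unfolding is_etriangle_def by blast
  have h: "k \<in> Hom X L P" "p \<in> Hom X P V" "\<rho> \<in> Ext X V L" "x \<in> Hom X Y I" "y \<in> Hom X I S"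
    "\<delta> \<in> Ext X S Y" using r t by (auto simp: etriangle_def)
  note o = etriangle_Ob[OF r] etriangle_Ob[OF t]
  show ?thesis
  proof
    assume L: "van L Y"
    show "van V S"
    proof (rule vanI[OF o(3,6)])
      fix \<theta> assume th: "\<theta> \<in> Ext X V S"
      \<comment> \<open>Classes on \<open>V\<close> come from maps on its syzygy because
        \<open>P\<close> has no extensions. Such a map will factor through \<open>k\<close>, and
        \<open>push X k \<rho>\<close> is zero.\<close>
      obtain f where f: "f \<in> Hom X L S" "push X f \<rho> = \<theta>"
        using Ext_exact_connecting_right[OF r th vanD[OF projective_van[OF assms(1) o(6)]
              pull_Ext[OF h(2) th]]] by blast
      obtain g where g: "g \<in> Hom X L I" "y \<cdot> g = f"
        using lift_to_middle[OF t f(1) vanD[OF L pull_Ext[OF f(1) h(6)]]] by blast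
      obtain j where j: "j \<in> Hom X P I" "j \<cdot> k = g"
        using assms(3) r g(1) unfolding injective_def by blast
      have "\<theta> = push X (y \<cdot> j) (push X k \<rho>)"
        using f(2) g(2) j(2) Cmp_assoc[OF h(1) j(1) h(5)] push_Cmp[OF h(3,1) Cmp_Hom[OF j(1) h(5)]]
        by simp
      thus "\<theta> = Ezero X V S"
        using push_inflation[OF r] push_Ezero[OF Cmp_Hom[OF j(1) h(5)] o(3)] by simp
    qed
  next
    assume V: "van V S"
    show "van L Y"
    proof (rule vanI[OF o(1,4)])
      fix \<theta> assume th: "\<theta> \<in> Ext X L Y"
      obtain f where f: "f \<in> Hom X L S" "pull X f \<delta> = \<theta>"
        using Ext_exact_connecting_left[OF t th vanD[OF injective_van[OF assms(3) o(1)]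
              push_Ext[OF h(4) th]]] by blast
      obtain g where g: "g \<in> Hom X P S" "g \<cdot> k = f"
        using extend_to_middle[OF r f(1) vanD[OF V push_Ext[OF f(1) h(3)]]] by blast
      obtain j where j: "j \<in> Hom X P I" "y \<cdot> j = g"
        using assms(1) t g(1) unfolding projective_def by blast
      have "\<theta> = pull X (j \<cdot> k) (pull X y \<delta>)"
        using f(2) g(2) j(2) Cmp_assoc[OF h(1) j(1) h(5)] pull_Cmp[OF h(6,5) Cmp_Hom[OF h(1) j(1)]]
        by simp
      thus "\<theta> = Ezero X L Y"
        using pull_deflation[OF t] pull_Ezero[OF Cmp_Hom[OF h(1) j(1)] o(4)] by simp
    qed
  qed
qed

lemma van_cone_covariant:
  assumes "projective X P" "tri L P V" "tri A B C" "van V B" "van L A"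
  shows "van V C"
proof -
  obtain k p \<rho> where r: "etriangle X L P V k p \<rho>" using assms(2) unfolding is_etriangle_def by blast
  obtain x y \<delta> where t: "etriangle X A B C x y \<delta>" using assms(3) unfolding is_etriangle_def by blast
  have h: "p \<in> Hom X P V" "\<rho> \<in> Ext X V L" "y \<in> Hom X B C" "\<delta> \<in> Ext X C A"
    using r t by (auto simp: etriangle_def)
  note o = etriangle_Ob[OF r] etriangle_Ob[OF t]
  show ?thesis
  proof (rule vanI[OF o(3,6)])
    fix \<theta> assume th: "\<theta> \<in> Ext X V C"
    \<comment> \<open>From here on the proof checks exactness of
      \<open>E(V, B) -> E(V, C) -> E(L, A)\<close>.\<close>
    obtain f where f: "f \<in> Hom X L C" "push X f \<rho> = \<theta>"
      using Ext_exact_connecting_right[OF r th vanD[OF projective_van[OF assms(1) o(6)]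
            pull_Ext[OF h(1) th]]] by blast
    obtain g where g: "g \<in> Hom X L B" "y \<cdot> g = f"
      using lift_to_middle[OF t f(1) vanD[OF assms(5) pull_Ext[OF f(1) h(4)]]] by blast
    show "\<theta> = Ezero X V C"
      using f(2) g(2) push_Cmp[OF h(2) g(1) h(3)] vanD[OF assms(4) push_Ext[OF g(1) h(2)]]
        push_Ezero[OF h(3) o(3)] by simp
  qed
qed

lemma van_cocone_covariant:
  assumes "projective X P" "tri L P V" "tri A B C" "van V C" "van L B"
  shows "van L A"
proof -
  obtain k p \<rho> where r: "etriangle X L P V k p \<rho>" using assms(2) unfolding is_etriangle_def by blast
  obtain x y \<delta> where t: "etriangle X A B C x y \<delta>" using assms(3) unfolding is_etriangle_def by blast
  have h: "k \<in> Hom X L P" "\<rho> \<in> Ext X V L" "x \<in> Hom X A B" "y \<in> Hom X B C" "\<delta> \<in> Ext X C A"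
    using r t by (auto simp: etriangle_def)
  note o = etriangle_Ob[OF r] etriangle_Ob[OF t]
  show ?thesis
  proof (rule vanI[OF o(1,4)])
    fix \<theta> assume th: "\<theta> \<in> Ext X L A"
    \<comment> \<open>Exactness of \<open>E(V, C) -> E(L, A) -> E(L, B)\<close>.\<close>
    obtain f where f: "f \<in> Hom X L C" "pull X f \<delta> = \<theta>"
      using Ext_exact_connecting_left[OF t th vanD[OF assms(5) push_Ext[OF h(3) th]]] by blast
    obtain g where g: "g \<in> Hom X P C" "g \<cdot> k = f"
      using extend_to_middle[OF r f(1) vanD[OF assms(4) push_Ext[OF f(1) h(2)]]] by blast
    obtain j where j: "j \<in> Hom X P B" "y \<cdot> j = g"
      using assms(1) t g(1) unfolding projective_def by blast
    have "\<theta> = pull X (j \<cdot> k) (pull X y \<delta>)"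
      using f(2) g(2) j(2) Cmp_assoc[OF h(1) j(1) h(4)] pull_Cmp[OF h(5,4) Cmp_Hom[OF h(1) j(1)]]
      by simp
    thus "\<theta> = Ezero X L A"
      using pull_deflation[OF t] pull_Ezero[OF Cmp_Hom[OF h(1) j(1)] o(4)] by simp
  qed
qed

lemma van_cocone_contravariant:
  assumes "injective X I" "tri Y I S" "tri A B C" "van B Y" "van C S"
  shows "van A Y"
proof -
  obtain i q \<rho> where r: "etriangle X Y I S i q \<rho>" using assms(2) unfolding is_etriangle_def by blast
  obtain x y \<delta> where t: "etriangle X A B C x y \<delta>" using assms(3) unfolding is_etriangle_def by blast
  have h: "i \<in> Hom X Y I" "\<rho> \<in> Ext X S Y" "x \<in> Hom X A B" "\<delta> \<in> Ext X C A"
    using r t by (auto simp: etriangle_def)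
  note o = etriangle_Ob[OF r] etriangle_Ob[OF t]
  show ?thesis
  proof (rule vanI[OF o(4,1)])
    fix \<theta> assume th: "\<theta> \<in> Ext X A Y"
    \<comment> \<open>Exactness of \<open>E(B, Y) -> E(A, Y) -> E(C, S)\<close>.\<close>
    obtain f where f: "f \<in> Hom X A S" "pull X f \<rho> = \<theta>"
      using Ext_exact_connecting_left[OF r th vanD[OF injective_van[OF assms(1) o(4)]
            push_Ext[OF h(1) th]]] by blast
    obtain g where g: "g \<in> Hom X B S" "g \<cdot> x = f"
      using extend_to_middle[OF t f(1) vanD[OF assms(5) push_Ext[OF f(1) h(4)]]] by blast
    show "\<theta> = Ezero X A Y"
      using f(2) g(2) pull_Cmp[OF h(2) g(1) h(3)] vanD[OF assms(4) pull_Ext[OF g(1) h(2)]]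
        pull_Ezero[OF h(3) o(1)] by simp
  qed
qed

lemma van_cone_contravariant:
  assumes "injective X I" "tri Y I S" "tri A B C" "van A Y" "van B S"
  shows "van C S"
proof -
  obtain i q \<rho> where r: "etriangle X Y I S i q \<rho>" using assms(2) unfolding is_etriangle_def by blast
  obtain x y \<delta> where t: "etriangle X A B C x y \<delta>" using assms(3) unfolding is_etriangle_def by blast
  have h: "q \<in> Hom X I S" "\<rho> \<in> Ext X S Y" "x \<in> Hom X A B" "y \<in> Hom X B C" "\<delta> \<in> Ext X C A"
    using r t by (auto simp: etriangle_def)
  note o = etriangle_Ob[OF r] etriangle_Ob[OF t]
  show ?thesis
  proof (rule vanI[OF o(6,3)])
    fix \<theta> assume th: "\<theta> \<in> Ext X C S"
    \<comment> \<open>Exactness of \<open>E(A, Y) -> E(C, S) -> E(B, S)\<close>.\<close>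
    obtain f where f: "f \<in> Hom X A S" "push X f \<delta> = \<theta>"
      using Ext_exact_connecting_right[OF t th vanD[OF assms(5) pull_Ext[OF h(4) th]]] by blast
    obtain g where g: "g \<in> Hom X A I" "q \<cdot> g = f"
      using lift_to_middle[OF r f(1) vanD[OF assms(4) pull_Ext[OF f(1) h(2)]]] by blast
    obtain j where j: "j \<in> Hom X B I" "j \<cdot> x = g"
      using assms(1) t g(1) unfolding injective_def by blast
    have "\<theta> = push X (q \<cdot> j) (push X x \<delta>)"
      using f(2) g(2) j(2) Cmp_assoc[OF h(3) j(1) h(1)] push_Cmp[OF h(5,3) Cmp_Hom[OF j(1) h(1)]]
      by simp
    thus "\<theta> = Ezero X C S"
      using push_inflation[OF t] push_Ezero[OF Cmp_Hom[OF j(1) h(1)] o(6)] by simp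
  qed
qed

end

section \<open>Higher extensions\<close>

locale extriangulated_with_enough = extriangulated_category +
  assumes enough_proj: "enough_projectives X" and enough_inj: "enough_injectives X"
begin

lemma ex_syzygy:
  assumes "V \<in> Ob X" shows "\<exists>P. projective X P \<and> tri (syzygy X V) P V"
  unfolding syzygy_def
  using enough_proj assms someI_ex[of "\<lambda>K. \<exists>P. projective X P \<and> tri K P V"]
  unfolding enough_projectives_def by blast

lemma ex_cosyzygy:
  assumes "Y \<in> Ob X" shows "\<exists>I S. injective X I \<and> tri Y I S"
  using enough_inj assms unfolding enough_injectives_def by blast

lemma syzygies_Ob: "V \<in> Ob X \<Longrightarrow> (syzygy X ^^ i) V \<in> Ob X"
  by (induction i) (use ex_syzygy tri_Ob in auto)

text \<open>\<open>E\<^sup>i\<^sup>+\<^sup>1(W, Y) = 0\<close>; the index is shifted.\<close>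

definition vz :: "nat \<Rightarrow> 'a \<Rightarrow> 'a \<Rightarrow> bool" where
  "vz i W Y \<longleftrightarrow> van ((syzygy X ^^ i) W) Y"

lemma vz_0: "vz 0 W Y \<longleftrightarrow> van W Y"
  by (simp add: vz_def)

lemma vz_Ob: "vz i W Y \<Longrightarrow> Y \<in> Ob X"
  unfolding vz_def using van_Ob by blast

lemma right_perp_iff: "Y \<in> right_perp X \<omega> \<longleftrightarrow> Y \<in> Ob X \<and> (\<forall>W\<in>\<omega>. \<forall>i. vz i W Y)"
proof -
  \<comment> \<open>\<open>higher_ext\<close> takes one syzygy fewer than its degree, so degree
    \<open>Suc i\<close> is \<open>vz i\<close>.\<close>
  have e: "carrier (higher_ext X (Suc i) W Y) = {\<one>\<^bsub>higher_ext X (Suc i) W Y\<^esub>} \<longleftrightarrow> vz i W Y" for i W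
    by (simp add: higher_ext_def ext_group_def vz_def van_def)
  have "(\<forall>i\<ge>1. \<forall>W\<in>\<omega>. carrier (higher_ext X i W Y) = {\<one>\<^bsub>higher_ext X i W Y\<^esub>})
      \<longleftrightarrow> (\<forall>i. \<forall>W\<in>\<omega>. vz i W Y)"
    unfolding e[symmetric] by (metis One_nat_def Suc_le_D le_add1 plus_1_eq_Suc)
  thus ?thesis unfolding right_perp_def by auto
qed

lemma vz_Suc_iff:
  assumes "W \<in> Ob X" "injective X I" "tri Y I S"
  shows "vz (Suc i) W Y \<longleftrightarrow> vz i W S"
  using ex_syzygy[OF syzygies_Ob[OF assms(1)]] van_syzygy_iff[OF _ _ assms(2,3)]
  unfolding vz_def by auto

lemma vz_middle:
  assumes "tri A B C" "vz i W A" "vz i W C" shows "vz i W B"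
  using assms van_middle_covariant unfolding vz_def by blast

lemma vz_cone:
  assumes "W \<in> Ob X" "tri A B C" "vz i W B" "vz (Suc i) W A" shows "vz i W C"
proof -
  obtain P where P: "projective X P" "tri (syzygy X ((syzygy X ^^ i) W)) P ((syzygy X ^^ i) W)"
    using ex_syzygy[OF syzygies_Ob[OF assms(1)]] by blast
  show ?thesis using van_cone_covariant[OF P assms(2)] assms(3,4) by (simp add: vz_def)
qed

lemma vz_cocone:
  assumes "W \<in> Ob X" "tri A B C" "vz i W C" "vz (Suc i) W B" shows "vz (Suc i) W A"
proof -
  obtain P where P: "projective X P" "tri (syzygy X ((syzygy X ^^ i) W)) P ((syzygy X ^^ i) W)"
    using ex_syzygy[OF syzygies_Ob[OF assms(1)]] by blast
  show ?thesis using van_cocone_covariant[OF P assms(2)] assms(3,4) by (simp add: vz_def)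
qed

text \<open>The chosen syzygies of \<open>A\<close>, \<open>B\<close> and \<open>C\<close> are not
  known to form a triangle, so the degree is lowered on the other side, replacing \<open>Y\<close>
  by a cosyzygy.\<close>

lemma vz_left_cocone:
  assumes "tri A B C" "vz i B Y" "vz (Suc i) C Y" shows "vz i A Y"
  using assms(2,3)
proof (induction i arbitrary: Y)
  case 0
  obtain I S where I: "injective X I" "tri Y I S" using ex_cosyzygy vz_Ob 0 by blast
  show ?case
    using van_cocone_contravariant[OF I assms(1)] 0 vz_Suc_iff[OF tri_Ob(3)[OF assms(1)] I]
    by (simp add: vz_0)
next
  case (Suc i)
  obtain I S where I: "injective X I" "tri Y I S" using ex_cosyzygy vz_Ob Suc.prems by blast
  show ?case using Suc vz_Suc_iff[OF _ I] tri_Ob[OF assms(1)] by blast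
qed

lemma vz_left_cone:
  assumes "tri A B C" "vz i A Y" "vz (Suc i) B Y" shows "vz (Suc i) C Y"
  using assms(2,3)
proof (induction i arbitrary: Y)
  case 0
  obtain I S where I: "injective X I" "tri Y I S" using ex_cosyzygy vz_Ob 0 by blast
  show ?case
    using van_cone_contravariant[OF I assms(1)] 0 vz_Suc_iff[OF _ I] tri_Ob[OF assms(1)]
    by (simp add: vz_0)
next
  case (Suc i)
  obtain I S where I: "injective X I" "tri Y I S" using ex_cosyzygy vz_Ob Suc.prems by blast
  show ?case using Suc vz_Suc_iff[OF _ I] tri_Ob[OF assms(1)] by blast
qed

end

section \<open>Resolutions and presentations\<close>

text \<open>The base of the inductions on the length of a presentation.\<close>

lemma Pres_0: "Pres X 0 \<U> \<V> = \<U>"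
  unfolding Pres_def by auto

lemma Pres_Suc_iff:
  "A \<in> Pres X (Suc n) \<U> \<V> \<longleftrightarrow> (\<exists>W\<in>\<V>. \<exists>K\<in>Pres X n \<U> \<V>. is_etriangle X K W A)"
proof
  assume "A \<in> Pres X (Suc n) \<U> \<V>"
  then obtain K W where K: "K 0 = A" "K (Suc n) \<in> \<U>"
    "\<forall>i<Suc n. W i \<in> \<V> \<and> is_etriangle X (K (Suc i)) (W i) (K i)"
    unfolding Pres_def by blast
  have "K (Suc 0) \<in> Pres X n \<U> \<V>"
    unfolding Pres_def using K
    by - (rule CollectI, rule exI[of _ "\<lambda>i. K (Suc i)"], rule exI[of _ "\<lambda>i. W (Suc i)"], auto)
  thus "\<exists>W\<in>\<V>. \<exists>K\<in>Pres X n \<U> \<V>. is_etriangle X K W A" using K by blast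
next
  assume "\<exists>W\<in>\<V>. \<exists>K\<in>Pres X n \<U> \<V>. is_etriangle X K W A"
  then obtain W0 K W where K: "W0 \<in> \<V>" "is_etriangle X (K 0) W0 A" "K n \<in> \<U>"
    "\<forall>i<n. W i \<in> \<V> \<and> is_etriangle X (K (Suc i)) (W i) (K i)"
    unfolding Pres_def by blast
  show "A \<in> Pres X (Suc n) \<U> \<V>"
    unfolding Pres_def using K
    by - (rule CollectI, rule exI[of _ "case_nat A K"], rule exI[of _ "case_nat W0 W"], auto split: nat.split)
qed

lemma Pres_SucI:
  "is_etriangle X K W A \<Longrightarrow> W \<in> \<V> \<Longrightarrow> K \<in> Pres X n \<U> \<V> \<Longrightarrow> A \<in> Pres X (Suc n) \<U> \<V>"
  unfolding Pres_Suc_iff by blast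

lemma res_le_eq_Pres: "res_le X \<omega> n = Pres X n \<omega> \<omega>"
  unfolding res_le_def Pres_def by simp

lemma cores_le_0: "cores_le X \<omega> 0 = \<omega>"
  unfolding cores_le_def by auto

lemma cores_le_Suc_iff:
  "A \<in> cores_le X \<omega> (Suc n) \<longleftrightarrow> (\<exists>W\<in>\<omega>. \<exists>F\<in>cores_le X \<omega> n. is_etriangle X A W F)"
proof
  assume "A \<in> cores_le X \<omega> (Suc n)"
  then obtain K W where K: "K 0 = A" "K (Suc n) \<in> \<omega>"
    "\<forall>i<Suc n. W i \<in> \<omega> \<and> is_etriangle X (K i) (W i) (K (Suc i))"
    unfolding cores_le_def by blast
  have "K (Suc 0) \<in> cores_le X \<omega> n"
    unfolding cores_le_def using K
    by - (rule CollectI, rule exI[of _ "\<lambda>i. K (Suc i)"], rule exI[of _ "\<lambda>i. W (Suc i)"], auto)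
  thus "\<exists>W\<in>\<omega>. \<exists>F\<in>cores_le X \<omega> n. is_etriangle X A W F" using K by blast
next
  assume "\<exists>W\<in>\<omega>. \<exists>F\<in>cores_le X \<omega> n. is_etriangle X A W F"
  then obtain W0 K W where K: "W0 \<in> \<omega>" "is_etriangle X A W0 (K 0)" "K n \<in> \<omega>"
    "\<forall>i<n. W i \<in> \<omega> \<and> is_etriangle X (K i) (W i) (K (Suc i))"
    unfolding cores_le_def by blast
  show "A \<in> cores_le X \<omega> (Suc n)"
    unfolding cores_le_def using K
    by - (rule CollectI, rule exI[of _ "case_nat A K"], rule exI[of _ "case_nat W0 W"], auto split: nat.split)
qed

lemma cores_le_SucI:
  "is_etriangle X A W F \<Longrightarrow> W \<in> \<omega> \<Longrightarrow> F \<in> cores_le X \<omega> n \<Longrightarrow> A \<in> cores_le X \<omega> (Suc n)"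
  unfolding cores_le_Suc_iff by blast

section \<open>Infinite resolutions in the perpendicular class\<close>

text \<open>Choosing one resolution step for each member of \<open>S\<close> and iterating the
  choice from \<open>A\<close> produces the infinite resolution.\<close>

lemma res_perp_coinduct:
  assumes "A \<in> S" "S \<subseteq> right_perp X \<omega>"
    and "\<And>A. A \<in> S \<Longrightarrow> \<exists>W\<in>\<omega>. \<exists>K\<in>S. is_etriangle X K W A"
  shows "A \<in> res_perp X \<omega>"
proof -
  obtain w k where wk: "\<And>A. A \<in> S \<Longrightarrow> w A \<in> \<omega> \<and> k A \<in> S \<and> is_etriangle X (k A) (w A) A"
    using assms(3) by metis
  have S: "(k ^^ i) A \<in> S" for i by (induction i) (use assms(1) wk in auto)
  show ?thesis
    unfolding res_perp_def using S wk assms(2)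
    by - (rule CollectI, rule exI[of _ "\<lambda>i. (k ^^ i) A"], rule exI[of _ "\<lambda>i. w ((k ^^ i) A)"], auto)
qed

lemma res_perp_subset_right_perp: "res_perp X \<omega> \<subseteq> right_perp X \<omega>"
  unfolding res_perp_def by blast

lemma res_perp_step:
  assumes "A \<in> res_perp X \<omega>"
  shows "\<exists>W\<in>\<omega>. \<exists>K\<in>res_perp X \<omega>. is_etriangle X K W A"
proof -
  obtain K W where K: "K 0 = A"
    "\<forall>i. W i \<in> \<omega> \<and> K i \<in> right_perp X \<omega> \<and> is_etriangle X (K (Suc i)) (W i) (K i)"
    using assms unfolding res_perp_def by blast
  have "K (Suc 0) \<in> res_perp X \<omega>"
    unfolding res_perp_def using K(2)
    by - (rule CollectI, rule exI[of _ "\<lambda>i. K (Suc i)"], rule exI[of _ "\<lambda>i. W (Suc i)"], auto)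
  thus ?thesis using K by blast
qed

lemma res_perp_intro:
  assumes "A \<in> right_perp X \<omega>" "W \<in> \<omega>" "K \<in> res_perp X \<omega>" "is_etriangle X K W A"
  shows "A \<in> res_perp X \<omega>"
proof (rule res_perp_coinduct[of A "insert A (res_perp X \<omega>)"])
  show "insert A (res_perp X \<omega>) \<subseteq> right_perp X \<omega>"
    using assms(1) res_perp_subset_right_perp[of X \<omega>] by simp
  show "\<exists>W\<in>\<omega>. \<exists>K\<in>insert A (res_perp X \<omega>). is_etriangle X K W B"
    if "B \<in> insert A (res_perp X \<omega>)" for B
    using that assms(2-4) res_perp_step[of _ X \<omega>] by blast
qed simp

section \<open>Orthogonality and finite resolutions\<close>

context extriangulated_with_enough
begin

lemma right_perp_Ob: "Y \<in> right_perp X \<omega> \<Longrightarrow> Y \<in> Ob X"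
  using right_perp_iff by blast

lemma right_perp_vz: "Y \<in> right_perp X \<omega> \<Longrightarrow> W \<in> \<omega> \<Longrightarrow> vz i W Y"
  using right_perp_iff by blast

lemma right_perp_van: "Y \<in> right_perp X \<omega> \<Longrightarrow> W \<in> \<omega> \<Longrightarrow> van W Y"
  using right_perp_vz[of Y \<omega> W 0] by (simp add: vz_0)

lemma right_perp_ext:
  "tri A B C \<Longrightarrow> A \<in> right_perp X \<omega> \<Longrightarrow> C \<in> right_perp X \<omega> \<Longrightarrow> B \<in> right_perp X \<omega>"
  unfolding right_perp_iff using vz_middle tri_Ob by blast

lemma right_perp_cone:
  "\<omega> \<subseteq> Ob X \<Longrightarrow> tri A B C \<Longrightarrow> A \<in> right_perp X \<omega> \<Longrightarrow> B \<in> right_perp X \<omega> \<Longrightarrow> C \<in> right_perp X \<omega>"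
  unfolding right_perp_iff using vz_cone tri_Ob by blast

lemma subcategory_Ob: "subcategory X \<omega> \<Longrightarrow> \<omega> \<subseteq> Ob X"
  unfolding subcategory_def by blast

lemma subcategory_zero: "subcategory X \<omega> \<Longrightarrow> \<exists>Z\<in>\<omega>. zero_object X Z"
  unfolding subcategory_def by blast

lemma zero_object_mem: "subcategory X \<omega> \<Longrightarrow> zero_object X Z \<Longrightarrow> Z \<in> \<omega>"
  using zero_objects_isomorphic unfolding subcategory_def by blast

lemma subcategory_middle:
  "subcategory X \<omega> \<Longrightarrow> tri A B C \<Longrightarrow> van C A \<Longrightarrow> A \<in> \<omega> \<Longrightarrow> C \<in> \<omega> \<Longrightarrow> B \<in> \<omega>"
  using van_split unfolding subcategory_def by blast

lemma subcategory_cone: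
  "subcategory X \<omega> \<Longrightarrow> tri A B C \<Longrightarrow> van C A \<Longrightarrow> B \<in> \<omega> \<Longrightarrow> C \<in> \<omega>"
  using direct_sum_of_swap[OF van_split] unfolding subcategory_def by blast

text \<open>A resolution is lengthened at its far end by a split triangle with zero cocone.\<close>

lemma res_le_mono:
  assumes "subcategory X \<omega>" "m \<le> n" shows "res_le X \<omega> m \<subseteq> res_le X \<omega> n"
proof (rule lift_Suc_mono_le[OF _ assms(2)])
  fix n
  have "A \<in> Pres X n \<omega> \<omega> \<longrightarrow> A \<in> Pres X (Suc n) \<omega> \<omega>" for A
  proof (induction n arbitrary: A)
    case 0
    show ?case
      using subcategory_zero[OF assms(1)] tri_identity_right subcategory_Ob[OF assms(1)]
      unfolding Pres_Suc_iff Pres_0 by blast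
  next
    case (Suc n)
    show ?case
    proof
      assume "A \<in> Pres X (Suc n) \<omega> \<omega>"
      then obtain W K where K: "W \<in> \<omega>" "K \<in> Pres X n \<omega> \<omega>" "tri K W A"
        unfolding Pres_Suc_iff by blast
      show "A \<in> Pres X (Suc (Suc n)) \<omega> \<omega>"
        using Pres_SucI[OF K(3,1)] Suc K(2) by blast
    qed
  qed
  thus "res_le X \<omega> n \<le> res_le X \<omega> (Suc n)" unfolding res_le_eq_Pres by blast
qed

lemma cores_le_mono:
  assumes "subcategory X \<omega>" "m \<le> n" shows "cores_le X \<omega> m \<subseteq> cores_le X \<omega> n"
proof (rule lift_Suc_mono_le[OF _ assms(2)])
  fix n
  have "A \<in> cores_le X \<omega> n \<longrightarrow> A \<in> cores_le X \<omega> (Suc n)" for A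
  proof (induction n arbitrary: A)
    case 0
    show ?case
      using subcategory_zero[OF assms(1)] tri_identity_left subcategory_Ob[OF assms(1)]
      unfolding cores_le_Suc_iff cores_le_0 by blast
  next
    case (Suc n)
    show ?case
    proof
      assume "A \<in> cores_le X \<omega> (Suc n)"
      then obtain W K where K: "W \<in> \<omega>" "K \<in> cores_le X \<omega> n" "tri A W K"
        unfolding cores_le_Suc_iff by blast
      show "A \<in> cores_le X \<omega> (Suc (Suc n))"
        using cores_le_SucI[OF K(3,1)] Suc K(2) by blast
    qed
  qed
  thus "cores_le X \<omega> n \<le> cores_le X \<omega> (Suc n)" by blast
qed

text \<open>Each of the \<open>n\<close> triangles shifts the degree from which extensions vanish up
  by one.\<close>

lemma res_le_vz:
  assumes "A \<in> res_le X \<omega> n" "Y \<in> right_perp X \<omega>" shows "vz (n + i) A Y"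
  using assms(1) unfolding res_le_eq_Pres
proof (induction n arbitrary: A)
  case 0
  thus ?case using right_perp_vz[OF assms(2)] by (simp add: Pres_0)
next
  case (Suc n)
  thus ?case using vz_left_cone right_perp_vz[OF assms(2)] unfolding Pres_Suc_iff by force
qed

lemma cores_le_vz:
  assumes "A \<in> cores_le X \<omega> n" "Y \<in> right_perp X \<omega>" shows "vz i A Y"
  using assms(1)
proof (induction n arbitrary: A i)
  case 0
  thus ?case using right_perp_vz[OF assms(2)] by (simp add: cores_le_0)
next
  case (Suc n)
  thus ?case using vz_left_cocone right_perp_vz[OF assms(2)] unfolding cores_le_Suc_iff by blast
qed

lemma cores_finite_vz: "A \<in> cores_finite X \<omega> \<Longrightarrow> Y \<in> right_perp X \<omega> \<Longrightarrow> vz i A Y"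
  unfolding cores_finite_def using cores_le_vz by blast

lemma cores_finite_van: "A \<in> cores_finite X \<omega> \<Longrightarrow> Y \<in> right_perp X \<omega> \<Longrightarrow> van A Y"
  using cores_finite_vz[of A \<omega> Y 0] by (simp add: vz_0)

lemma subset_cores_finite: "\<omega> \<subseteq> cores_finite X \<omega>"
proof
  fix A assume "A \<in> \<omega>"
  hence "A \<in> cores_le X \<omega> 0" by (simp add: cores_le_0)
  thus "A \<in> cores_finite X \<omega>" unfolding cores_finite_def by blast
qed

lemma cores_finite_intro:
  "tri A W F \<Longrightarrow> W \<in> \<omega> \<Longrightarrow> F \<in> cores_finite X \<omega> \<Longrightarrow> A \<in> cores_finite X \<omega>"
  unfolding cores_finite_def using cores_le_SucI[of X A W F \<omega>] by blast

lemma cores_finite_step: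
  assumes "subcategory X \<omega>" "A \<in> cores_finite X \<omega>"
  shows "\<exists>W\<in>\<omega>. \<exists>F\<in>cores_finite X \<omega>. tri A W F"
proof -
  obtain n where "A \<in> cores_le X \<omega> n" using assms(2) unfolding cores_finite_def by blast
  hence "A \<in> cores_le X \<omega> (Suc n)" using cores_le_mono[OF assms(1) le_SucI[OF order_refl]] by blast
  thus ?thesis unfolding cores_le_Suc_iff cores_finite_def by blast
qed

text \<open>A horseshoe argument for coresolutions: the first terms \<open>W\<close> and
  \<open>V\<close> combine to \<open>N\<close>, and the cone of \<open>B -> N\<close> is an
  extension of the two remaining cones.\<close>

lemma cores_le_ext:
  assumes "subcategory X \<omega>" "self_orthogonal X \<omega>"
    and "tri A B C" "A \<in> cores_le X \<omega> n" "C \<in> cores_le X \<omega> n"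
  shows "B \<in> cores_le X \<omega> n"
  using assms(3-5)
proof (induction n arbitrary: A B C)
  case 0
  thus ?case
    using subcategory_middle[OF assms(1)] right_perp_van assms(2)
    unfolding cores_le_0 self_orthogonal_def by blast
next
  case (Suc n)
  obtain W A' where A: "W \<in> \<omega>" "A' \<in> cores_le X \<omega> n" "tri A W A'"
    using Suc.prems(2) unfolding cores_le_Suc_iff by blast
  obtain V C' where C: "V \<in> \<omega>" "C' \<in> cores_le X \<omega> n" "tri C V C'"
    using Suc.prems(3) unfolding cores_le_Suc_iff by blast
  have W: "W \<in> right_perp X \<omega>" using A(1) assms(2) unfolding self_orthogonal_def by blast
  obtain M where M: "tri B M A'" "tri W M C" using pushout[OF Suc.prems(1) A(3)] by blast
  \<comment> \<open>The triangle \<open>W -> M -> C\<close> splits, so it can be turned round and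
    pushed out along \<open>C -> V\<close>.\<close>
  have "van C W" using cores_le_vz[OF Suc.prems(3) W, of 0] by (simp add: vz_0)
  hence "tri C M W" using van_swap[OF M(2)] by blast
  then obtain N where N: "tri M N C'" "tri V N W" using pushout C(3) by blast
  have "N \<in> \<omega>" using subcategory_middle[OF assms(1) N(2) right_perp_van[OF _ A(1)] C(1) A(1)]
      C(1) assms(2) unfolding self_orthogonal_def by blast
  obtain G where G: "tri B N G" "tri A' G C'" using inflation_comp[OF M(1) N(1)] by blast
  show ?case using cores_le_SucI[OF G(1) \<open>N \<in> \<omega>\<close> Suc.IH[OF G(2) A(2) C(2)]] .
qed

lemma cores_finite_ext:
  assumes "subcategory X \<omega>" "self_orthogonal X \<omega>"
    and "tri A B C" "A \<in> cores_finite X \<omega>" "C \<in> cores_finite X \<omega>"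
  shows "B \<in> cores_finite X \<omega>"
proof -
  obtain i j where "A \<in> cores_le X \<omega> i" "C \<in> cores_le X \<omega> j"
    using assms(4,5) unfolding cores_finite_def by blast
  hence "A \<in> cores_le X \<omega> (max i j)" "C \<in> cores_le X \<omega> (max i j)"
    using cores_le_mono[OF assms(1)] max.cobounded1 max.cobounded2 by blast+
  thus ?thesis using cores_le_ext[OF assms(1-3)] unfolding cores_finite_def by blast
qed

text \<open>Passing to a cone lowers the vanishing degree by one, so \<open>n\<close> cones bring
  \<open>n + i\<close> down to \<open>i\<close>.\<close>

lemma Pres_vz:
  assumes "W \<in> Ob X" "\<And>V i. V \<in> \<V> \<Longrightarrow> vz i W V" "\<And>U. U \<in> \<U> \<Longrightarrow> vz (n + i) W U"
    and "A \<in> Pres X n \<U> \<V>"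
  shows "vz i W A"
  using assms(3,4)
proof (induction n arbitrary: A i)
  case 0
  thus ?case by (simp add: Pres_0)
next
  case (Suc n)
  obtain V K where V: "V \<in> \<V>" "K \<in> Pres X n \<U> \<V>" "tri K V A"
    using Suc.prems(2) unfolding Pres_Suc_iff by blast
  have "vz (Suc i) W K"
  proof (rule Suc.IH[OF _ V(2)])
    fix U assume "U \<in> \<U>"
    thus "vz (n + Suc i) W U" using Suc.prems(1)[of U] by simp
  qed
  thus ?case using vz_cone[OF assms(1) V(3)] assms(2)[OF V(1)] by blast
qed

text \<open>In degree one the vanishing is the approximation property; in higher degrees it follows
  from the vanishing for \<open>A\<close> and \<open>W\<close>.\<close>

lemma approximation_cocone:
  assumes "\<omega> \<subseteq> Ob X" "self_orthogonal X \<omega>" "strongly_contravariantly_finite X \<omega>"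
    and "A \<in> right_perp X \<omega>"
  shows "\<exists>K\<in>right_perp X \<omega>. \<exists>W\<in>\<omega>. tri K W A"
proof -
  obtain K W k g \<delta> where t: "etriangle X K W A k g \<delta>" "right_approximation X \<omega> W A g"
    using assms(3) right_perp_Ob[OF assms(4)] unfolding strongly_contravariantly_finite_def by blast
  have W: "W \<in> \<omega>" "W \<in> right_perp X \<omega>"
    using t(2) assms(2) unfolding right_approximation_def self_orthogonal_def by blast+
  have tri: "tri K W A" using t(1) unfolding is_etriangle_def by blast
  have "vz i V K" if V: "V \<in> \<omega>" for V i
  proof (cases i)
    case 0
    thus ?thesis
      using van_approximation_cocone[OF t V right_perp_van[OF W(2) V]] by (simp add: vz_0)
  next
    case (Suc j)
    thus ?thesis using vz_cocone[OF _ tri right_perp_vz right_perp_vz, OF _ assms(4) V W(2) V]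
        assms(1) V by blast
  qed
  thus ?thesis using tri W(1) tri_Ob[OF tri] right_perp_iff by blast
qed

end

section \<open>The class \<open>\<X>\<close>\<close>

locale self_orthogonal_subcategory = extriangulated_with_enough +
  fixes \<C>
  assumes subcategory_C: "subcategory X \<C>" and self_orthogonal_C: "self_orthogonal X \<C>"
begin

abbreviation "\<X> \<equiv> res_perp X \<C>"

lemma C_Ob: "\<C> \<subseteq> Ob X"
  using subcategory_Ob subcategory_C .

lemma C_perp: "\<C> \<subseteq> right_perp X \<C>"
  using self_orthogonal_C by (simp add: self_orthogonal_def)

lemma res_perp_perp: "A \<in> \<X> \<Longrightarrow> A \<in> right_perp X \<C>"
  using res_perp_subset_right_perp[of X \<C>] by blast

lemma res_perp_Ob: "A \<in> \<X> \<Longrightarrow> A \<in> Ob X"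
  using res_perp_perp right_perp_Ob by blast

lemma C_res_perp: "\<C> \<subseteq> \<X>"
proof
  fix A assume "A \<in> \<C>"
  thus "A \<in> \<X>"
  proof (rule res_perp_coinduct[OF _ C_perp])
    show "\<exists>W\<in>\<C>. \<exists>K\<in>\<C>. tri K W A" if "A \<in> \<C>" for A
      using subcategory_zero[OF subcategory_C] tri_identity_right C_Ob that by blast
  qed
qed

text \<open>A horseshoe argument: \<open>\<C>\<close>-covers \<open>W\<^sub>A \<rightarrow> A\<close> and \<open>W\<^sub>C \<rightarrow> C\<close> with cocones in \<open>\<X>\<close> yield
  \<open>N \<rightarrow> B\<close> with \<open>N\<close> an extension of \<open>W\<^sub>A\<close> by \<open>W\<^sub>C\<close>, whose cocone is again an extension of two
  objects of \<open>\<X>\<close>.\<close>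

lemma res_perp_ext:
  assumes "tri A B C" "A \<in> \<X>" "C \<in> \<X>" shows "B \<in> \<X>"
proof (rule res_perp_coinduct[of _ "{B. \<exists>A\<in>\<X>. \<exists>C\<in>\<X>. tri A B C}"])
  show "B \<in> {B. \<exists>A\<in>\<X>. \<exists>C\<in>\<X>. tri A B C}" using assms by blast
  show "{B. \<exists>A\<in>\<X>. \<exists>C\<in>\<X>. tri A B C} \<subseteq> right_perp X \<C>"
    using right_perp_ext res_perp_perp by blast
  fix B assume "B \<in> {B. \<exists>A\<in>\<X>. \<exists>C\<in>\<X>. tri A B C}"
  then obtain A C where B: "tri A B C" "A \<in> \<X>" "C \<in> \<X>" by blast
  obtain WA KA where A: "WA \<in> \<C>" "KA \<in> \<X>" "tri KA WA A" using res_perp_step[OF B(2)] by blast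
  obtain WC KC where C: "WC \<in> \<C>" "KC \<in> \<X>" "tri KC WC C" using res_perp_step[OF B(3)] by blast
  obtain M where M: "tri A M WC" "tri KC M B" using pullback[OF B(1) C(3)] by blast
  have "tri WC M A" using van_swap[OF M(1) right_perp_van[OF res_perp_perp[OF B(2)] C(1)]] .
  then obtain N where N: "tri WC N WA" "tri KA N M" using pullback A(3) by blast
  have "N \<in> \<C>"
    using subcategory_middle[OF subcategory_C N(1)] right_perp_van C_perp A(1) C(1) by blast
  moreover obtain E where "tri E N B" "tri KA E KC" using deflation_comp[OF M(2) N(2)] by blast
  ultimately show "\<exists>W\<in>\<C>. \<exists>K\<in>{B. \<exists>A\<in>\<X>. \<exists>C\<in>\<X>. tri A B C}. tri K W B" using A(2) C(2) by blast
qed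

lemma res_perp_cone:
  assumes "tri A B C" "A \<in> \<X>" "B \<in> \<X>" shows "C \<in> \<X>"
proof -
  obtain W K where W: "W \<in> \<C>" "K \<in> \<X>" "tri K W B" using res_perp_step[OF assms(3)] by blast
  \<comment> \<open>The cocone of \<open>W -> B -> C\<close> is an extension of \<open>A\<close> by
    \<open>K\<close>, so it stays in \<open>\<X>\<close>.\<close>
  obtain E where E: "tri E W C" "tri K E A" using deflation_comp[OF assms(1) W(3)] by blast
  show ?thesis
    using res_perp_intro[OF right_perp_cone[OF C_Ob assms(1)] W(1) _ E(1)] res_perp_ext[OF E(2)]
      W(2) assms(2,3) res_perp_perp by blast
qed

text \<open>\<open>K\<close> is compared with a cocone \<open>L\<close> already known to lie in
  \<open>\<X>\<close>. The pullback \<open>M\<close> is an extension of \<open>W\<close> by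
  \<open>L\<close>, and it splits over \<open>V\<close>, so \<open>K\<close> becomes a cone of
  \<open>V -> M\<close>.\<close>

lemma res_perp_cocone:
  assumes "tri K W A" "A \<in> \<X>" "W \<in> \<X>" "tri L V A" "L \<in> \<X>" "V \<in> \<X>" "van V K"
  shows "K \<in> \<X>"
proof -
  obtain M where M: "tri K M V" "tri L M W" using pullback[OF assms(1,4)] by blast
  have "tri V M K" using van_swap[OF M(1) assms(7)] .
  thus ?thesis using res_perp_cone res_perp_ext[OF M(2)] assms by blast
qed

lemma Pres_res_perp:
  assumes "\<V> \<subseteq> \<X>" "\<U> \<subseteq> \<X>" shows "Pres X n \<U> \<V> \<subseteq> \<X>"
proof
  show "A \<in> \<X>" if "A \<in> Pres X n \<U> \<V>" for A
    using that
  proof (induction n arbitrary: A)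
    case 0
    thus ?case using assms by (auto simp: Pres_0)
  next
    case (Suc n)
    thus ?case using res_perp_cone assms(1) unfolding Pres_Suc_iff by blast
  qed
qed

lemma res_le_res_perp: "res_le X \<C> n \<subseteq> \<X>"
  unfolding res_le_eq_Pres using Pres_res_perp C_res_perp by blast

text \<open>Vanishing against all of \<open>\<X>\<close> includes vanishing against the next syzygy.
  After \<open>n\<close> steps this splits the \<open>\<C>\<close>-cover, and the last syzygy is a
  summand of an object of \<open>\<C>\<close>.\<close>

lemma res_perp_res_le:
  assumes "A \<in> \<X>" "\<And>Y. Y \<in> \<X> \<Longrightarrow> vz n A Y" shows "A \<in> res_le X \<C> n"
  using assms
proof (induction n arbitrary: A)
  case 0
  obtain W K where W: "W \<in> \<C>" "K \<in> \<X>" "tri K W A" using res_perp_step[OF 0(1)] by blast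
  have "van A K" using 0(2)[OF W(2)] by (simp add: vz_0)
  hence "A \<in> \<C>" using subcategory_cone[OF subcategory_C W(3)] W(1) by blast
  thus ?case by (simp add: res_le_eq_Pres Pres_0)
next
  case (Suc n)
  obtain W K where W: "W \<in> \<C>" "K \<in> \<X>" "tri K W A" using res_perp_step[OF Suc.prems(1)] by blast
  have "vz n K Y" if "Y \<in> \<X>" for Y
    using vz_left_cocone[OF W(3) right_perp_vz[OF res_perp_perp[OF that] W(1)] Suc.prems(2)[OF that]] .
  hence "K \<in> res_le X \<C> n" using Suc.IH W(2) by blast
  thus ?case using W(1,3) unfolding res_le_eq_Pres Pres_Suc_iff by blast
qed

section \<open>From a tilting pair to the equality of classes\<close>

lemma Pres_eq_of_n_tilting_pair:
  assumes T: "n_tilting_pair X n \<C> \<T>" and fin: "strongly_contravariantly_finite X \<T>"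
  shows "Pres X n \<X> \<T> = right_perp X \<T> \<inter> \<X>"
proof
  have t: "subcategory X \<T>" "self_orthogonal X \<T>" "\<T> \<subseteq> res_finite X \<C>" "\<C> \<subseteq> cores_finite X \<T>"
    "\<And>M. M \<in> \<T> \<Longrightarrow> res_dim X \<C> M \<le> n"
    using T unfolding n_tilting_pair_def tilting_pair_def by blast+
  have res: "\<T> \<subseteq> res_le X \<C> n"
  proof
    fix M assume M: "M \<in> \<T>"
    then obtain m where "M \<in> res_le X \<C> m" using t(3) unfolding res_finite_def by blast
    hence "M \<in> res_le X \<C> (res_dim X \<C> M)" unfolding res_dim_def by (rule LeastI)
    thus "M \<in> res_le X \<C> n" using res_le_mono[OF subcategory_C t(5)[OF M]] by blast
  qed
  hence TX: "\<T> \<subseteq> \<X>" using res_le_res_perp by blast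
  have TT: "\<T> \<subseteq> right_perp X \<T>" using t(2) by (simp add: self_orthogonal_def)
  show "Pres X n \<X> \<T> \<subseteq> right_perp X \<T> \<inter> \<X>"
  proof
    fix A assume A: "A \<in> Pres X n \<X> \<T>"
    have "vz i W A" if W: "W \<in> \<T>" for W i
    proof (rule Pres_vz[OF _ _ _ A])
      show "W \<in> Ob X" using W subcategory_Ob[OF t(1)] by blast
      show "vz i W V" if "V \<in> \<T>" for V i using right_perp_vz TT W that by blast
      show "vz (n + i) W U" if "U \<in> \<X>" for U
        using res_le_vz res W res_perp_perp[OF that] by blast
    qed
    moreover have "A \<in> \<X>" using A Pres_res_perp[OF TX order_refl] by blast
    ultimately show "A \<in> right_perp X \<T> \<inter> \<X>" using res_perp_Ob right_perp_iff by blast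
  qed
  \<comment> \<open>Finite \<open>\<T>\<close>-coresolutions transfer vanishing from
    \<open>\<T>\<close> to \<open>\<C>\<close>.\<close>
  have TC: "right_perp X \<T> \<subseteq> right_perp X \<C>"
    using cores_finite_vz t(4) right_perp_Ob right_perp_iff[of _ \<C>] by blast
  have "A \<in> Pres X m \<X> \<T>" if "A \<in> right_perp X \<T> \<inter> \<X>" for A m
    using that
  proof (induction m arbitrary: A)
    case 0
    thus ?case by (simp add: Pres_0)
  next
    case (Suc m)
    obtain K W where K: "K \<in> right_perp X \<T>" "W \<in> \<T>" "tri K W A"
      using approximation_cocone[OF subcategory_Ob[OF t(1)] t(2) fin] Suc.prems by blast
    \<comment> \<open>The \<open>\<C>\<close>-cover of \<open>A\<close> is the comparison triangle
      that puts \<open>K\<close> into \<open>\<X>\<close>; extensions of \<open>V\<close> by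
      \<open>K\<close> vanish because \<open>K\<close> is also perpendicular to
      \<open>\<C>\<close>.\<close>
    obtain V L where L: "V \<in> \<C>" "L \<in> \<X>" "tri L V A" using res_perp_step[of A X \<C>] Suc.prems by blast
    have "K \<in> \<X>"
      using res_perp_cocone[OF K(3) _ _ L(3,2)] right_perp_van[OF _ L(1)] TC K(1,2) L(1) C_res_perp
        TX Suc.prems by blast
    thus ?case using Suc.IH Suc.prems K Pres_SucI[OF K(3,2)] by blast
  qed
  thus "right_perp X \<T> \<inter> \<X> \<subseteq> Pres X n \<X> \<T>" by blast
qed

end

section \<open>Tilting from presentations\<close>

locale perp_presented = self_orthogonal_subcategory +
  fixes \<T> and n :: nat
  assumes subcategory_T: "subcategory X \<T>"
    and n_pos: "n \<ge> 1"
    and C_Copres: "\<C> \<subseteq> Copres X n (Pres X n \<X> \<T>)"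
    and T_finite: "strongly_contravariantly_finite X \<T>"
    and Pres_eq: "Pres X n \<X> \<T> = right_perp X \<T> \<inter> \<X>"
begin

abbreviation "\<P> \<equiv> right_perp X \<T> \<inter> \<X>"

lemma T_Ob: "\<T> \<subseteq> Ob X"
  using subcategory_Ob subcategory_T .

text \<open>An object of \<open>\<T>\<close> is presented by its identity followed by zero objects;
  the condition \<open>n \<ge> 1\<close> leaves room for the identity.\<close>

lemma T_sub_P: "\<T> \<subseteq> \<P>"
proof -
  obtain Z where Z: "Z \<in> \<C>" "zero_object X Z" using subcategory_zero[OF subcategory_C] by blast
  have ZT: "Z \<in> \<T>" using zero_object_mem[OF subcategory_T Z(2)] .
  have "Z \<in> Pres X m \<X> \<T>" for m
  proof (induction m)
    case 0
    show ?case using Z(1) C_res_perp by (auto simp: Pres_0)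
  next
    case (Suc m)
    show ?case using Pres_SucI[OF tri_identity_right[OF Z(2)] ZT Suc] ZT T_Ob by blast
  qed
  hence "A \<in> Pres X (Suc m) \<X> \<T>" if "A \<in> \<T>" for A m
    using Pres_SucI[OF tri_identity_right[OF Z(2)] that] that T_Ob by blast
  moreover obtain m where "n = Suc m" using n_pos by (cases n) auto
  ultimately have "\<T> \<subseteq> Pres X n \<X> \<T>" by blast
  thus ?thesis by (simp add: Pres_eq)
qed

lemma self_orthogonal_T: "self_orthogonal X \<T>"
  using T_sub_P unfolding self_orthogonal_def by blast

section \<open>Covers of objects of \<open>\<P>\<close> and presentations by
  \<open>\<P>\<close>\<close>

lemma P_ext: "tri A B C \<Longrightarrow> A \<in> \<P> \<Longrightarrow> C \<in> \<P> \<Longrightarrow> B \<in> \<P>"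
  using right_perp_ext res_perp_ext by blast

text \<open>Two triangles are compared: the approximation has its cocone in the perpendicular class,
  the first step of a presentation has its cocone in \<open>\<X>\<close>. The comparison puts the
  first cocone into both.\<close>

lemma P_cover:
  assumes "A \<in> \<P>" shows "\<exists>K\<in>\<P>. \<exists>W\<in>\<T>. tri K W A"
proof -
  obtain K W where K: "K \<in> right_perp X \<T>" "W \<in> \<T>" "tri K W A"
    using approximation_cocone[OF T_Ob self_orthogonal_T T_finite] assms by blast
  obtain m where m: "n = Suc m" using n_pos by (cases n) auto
  obtain V L where L: "V \<in> \<T>" "L \<in> Pres X m \<X> \<T>" "tri L V A"
    using assms unfolding Pres_eq[symmetric] m Pres_Suc_iff by blast
  have "L \<in> \<X>" using L(2) Pres_res_perp[OF _ order_refl] T_sub_P by blast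
  hence "K \<in> \<X>"
    using res_perp_cocone[OF K(3) _ _ L(3)] right_perp_van[OF K(1) L(1)] assms K(2) L(1) T_sub_P
    by blast
  thus ?thesis using K by blast
qed

text \<open>Pulling the first step \<open>Q -> K\<close> back along \<open>E -> K\<close> keeps its
  cocone and replaces \<open>Q\<close> by an extension of \<open>Q\<close> by \<open>L\<close>,
  still in \<open>\<P>\<close>.\<close>

lemma Pres_P_ext:
  assumes "tri L E K" "L \<in> \<P>" "K \<in> Pres X m \<X> \<P>" shows "E \<in> Pres X m \<X> \<P>"
proof (cases m)
  case 0
  thus ?thesis using assms res_perp_ext by (auto simp: Pres_0)
next
  case (Suc k)
  obtain Q K' where Q: "Q \<in> \<P>" "K' \<in> Pres X k \<X> \<P>" "tri K' Q K"
    using assms(3) unfolding Suc Pres_Suc_iff by blast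
  have "\<exists>M. tri L M Q \<and> tri K' M E" using pullback[OF assms(1) Q(3)] .
  then obtain M where M: "tri K' M E" "M \<in> \<P>" using P_ext assms(2) Q(1) by blast
  show ?thesis unfolding Suc by (rule Pres_SucI[OF M Q(2)])
qed

text \<open>The first term \<open>Q\<close> is replaced by its \<open>\<T>\<close>-cover. The new
  cocone is an extension of \<open>K\<close> by \<open>L\<close>, and by \<open>Pres_P_ext\<close>
  it keeps a presentation of the same length.\<close>

lemma Pres_P_Pres_T: "A \<in> Pres X m \<X> \<P> \<Longrightarrow> A \<in> Pres X m \<X> \<T>"
proof (induction m arbitrary: A)
  case 0
  thus ?case by (simp add: Pres_0)
next
  case (Suc m)
  obtain Q K where Q: "Q \<in> \<P>" "K \<in> Pres X m \<X> \<P>" "tri K Q A"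
    using Suc.prems unfolding Pres_Suc_iff by blast
  obtain L W where L: "L \<in> \<P>" "W \<in> \<T>" "tri L W Q" using P_cover[OF Q(1)] by blast
  obtain E where E: "tri E W A" "tri L E K" using deflation_comp[OF Q(3) L(3)] by blast
  show ?case using Pres_SucI[OF E(1) L(2) Suc.IH[OF Pres_P_ext[OF E(2) L(1) Q(2)]]] .
qed

lemma Pres_P_subset: "Pres X n \<X> \<P> \<subseteq> \<P>"
  using Pres_P_Pres_T Pres_eq by blast

section \<open>Envelopes with finite \<open>\<T>\<close>-coresolution of the cone\<close>

lemma cores_le_P_envelope:
  "A \<in> cores_le X \<P> m \<Longrightarrow> \<exists>Q\<in>\<P>. \<exists>F\<in>cores_finite X \<T>. tri A Q F"
proof (induction m arbitrary: A)
  case 0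
  obtain Z where Z: "Z \<in> \<T>" "zero_object X Z" using subcategory_zero[OF subcategory_T] by blast
  have "A \<in> \<P>" using 0 by (simp add: cores_le_0)
  moreover from this have "tri A A Z" using tri_identity_left[OF Z(2)] res_perp_Ob by blast
  ultimately show ?case using Z(1) subset_cores_finite by blast
next
  case (Suc m)
  obtain Q A' where Q: "Q \<in> \<P>" "A' \<in> cores_le X \<P> m" "tri A Q A'"
    using Suc.prems unfolding cores_le_Suc_iff by blast
  obtain Q' F where F: "Q' \<in> \<P>" "F \<in> cores_finite X \<T>" "tri A' Q' F" using Suc.IH[OF Q(2)] by blast
  obtain L W where L: "L \<in> \<P>" "W \<in> \<T>" "tri L W Q'" using P_cover[OF F(1)] by blast
  \<comment> \<open>Covering \<open>Q'\<close> by \<open>W\<close> replaces \<open>A'\<close> by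
    \<open>E\<close>, which has a finite \<open>\<T>\<close>-coresolution; the pullback with
    \<open>Q\<close> then puts \<open>A\<close> in \<open>M\<close> with cone
    \<open>E\<close>.\<close>
  obtain E where E: "tri E W F" "tri L E A'" using deflation_comp[OF F(3) L(3)] by blast
  obtain M where M: "tri A M E" "tri L M Q" using pullback[OF Q(3) E(2)] by blast
  have "M \<in> \<P>" using P_ext[OF M(2) L(1) Q(1)] .
  thus ?case using M(1) cores_finite_intro[OF E(1) L(2) F(2)] by blast
qed

lemma C_envelope:
  assumes "A \<in> \<C>" shows "\<exists>Q\<in>\<P>. \<exists>F\<in>cores_finite X \<T>. tri A Q F"
proof -
  obtain K W where K: "K 0 = A" "\<forall>i<n. W i \<in> \<P> \<and> tri (K i) (W i) (K (Suc i))"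
    using C_Copres assms unfolding Pres_eq Copres_def by blast
  \<comment> \<open>Read from the other end, the copresentation of \<open>A\<close> presents each
    \<open>K i\<close>, with \<open>A\<close> itself as the term in \<open>\<X>\<close>. At
    \<open>i = n\<close> this puts the last cone into \<open>\<P>\<close>.\<close>
  have "i \<le> n \<Longrightarrow> K i \<in> Pres X i \<X> \<P>" for i
  proof (induction i)
    case 0
    show ?case using K(1) assms C_res_perp by (auto simp: Pres_0)
  next
    case (Suc i)
    thus ?case using K(2) Pres_SucI[of X "K i" "W i" "K (Suc i)"] by simp
  qed
  hence "K n \<in> \<P>" using Pres_P_subset by blast
  hence "A \<in> cores_le X \<P> n" using K unfolding cores_le_def by blast
  thus ?thesis by (rule cores_le_P_envelope)
qed

text \<open>Each induction step adds one term of \<open>\<P>\<close> to the presentation of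
  \<open>E\<close>; for \<open>m = n\<close> this makes \<open>E\<close> an object of
  \<open>\<P>\<close>.\<close>

lemma res_perp_Pres_envelope:
  "Y \<in> \<X> \<Longrightarrow> \<exists>E\<in>Pres X m \<X> \<P>. \<exists>D\<in>cores_finite X \<T>. tri Y E D"
proof (induction m arbitrary: Y)
  case 0
  obtain Z where Z: "Z \<in> \<T>" "zero_object X Z" using subcategory_zero[OF subcategory_T] by blast
  have "tri Y Y Z" using tri_identity_left[OF Z(2)] res_perp_Ob 0 by blast
  thus ?case using 0 Z(1) subset_cores_finite unfolding Pres_0 by blast
next
  case (Suc m)
  obtain C0 Y1 where Y: "C0 \<in> \<C>" "Y1 \<in> \<X>" "tri Y1 C0 Y" using res_perp_step[OF Suc.prems] by blast
  obtain E1 D1 where E: "E1 \<in> Pres X m \<X> \<P>" "D1 \<in> cores_finite X \<T>" "tri Y1 E1 D1"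
    using Suc.IH[OF Y(2)] by blast
  obtain Q F where Q: "Q \<in> \<P>" "F \<in> cores_finite X \<T>" "tri C0 Q F" using C_envelope[OF Y(1)] by blast
  obtain W D2 where D: "W \<in> \<T>" "D2 \<in> cores_finite X \<T>" "tri D1 W D2"
    using cores_finite_step[OF subcategory_T E(2)] by blast
  \<comment> \<open>First glue the envelope of \<open>Y1\<close> to \<open>C0\<close>, then push out
    along the envelope of \<open>C0\<close>.\<close>
  obtain M where M: "tri C0 M D1" "tri E1 M Y" using pushout[OF Y(3) E(3)] by blast
  obtain N where N: "tri M N F" "tri Q N D1" using pushout[OF M(1) Q(3)] by blast
  \<comment> \<open>\<open>N\<close> need not lie in \<open>\<P>\<close>, as \<open>D1\<close> is
    only coresolved by \<open>\<T>\<close>. Splitting allows \<open>D1\<close> to be enlarged to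
    \<open>W\<close>, which gives \<open>N'\<close> in \<open>\<P>\<close>.\<close>
  have "tri D1 N Q" using van_swap[OF N(2) cores_finite_van[OF E(2)]] Q(1) by blast
  then obtain N' where N': "tri N N' D2" "tri W N' Q" using pushout D(3) by blast
  have P: "N' \<in> \<P>" using P_ext[OF N'(2)] D(1) T_sub_P Q(1) by blast
  obtain G where G: "tri M N' G" "tri F G D2" using inflation_comp[OF N(1) N'(1)] by blast
  have GT: "G \<in> cores_finite X \<T>"
    using cores_finite_ext[OF subcategory_T self_orthogonal_T G(2) Q(2) D(2)] .
  \<comment> \<open>The cone \<open>H\<close> of \<open>E1 -> M -> N'\<close> contains
    \<open>Y\<close>, the cone of \<open>E1 -> M\<close>, with quotient \<open>G\<close>.\<close>
  obtain H where H: "tri E1 N' H" "tri Y H G" using inflation_comp[OF M(2) G(1)] by blast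
  show ?case using Pres_SucI[OF H(1) P E(1)] H(2) GT by blast
qed

lemma res_perp_envelope:
  assumes "Y \<in> \<X>" shows "\<exists>E\<in>\<P>. \<exists>D\<in>\<X>. tri Y E D"
proof -
  obtain E D where E: "E \<in> \<P>" "tri Y E D"
    using res_perp_Pres_envelope[OF assms, of n] Pres_P_subset by blast
  thus ?thesis using res_perp_cone[OF E(2) assms] by blast
qed

section \<open>The tilting conditions\<close>

text \<open>A shorter presentation costs a higher degree: the cone \<open>D\<close> of an envelope
  of \<open>Y\<close> has a presentation one term longer, so its vanishing is known one degree
  lower. The range runs from \<open>\<P>\<close> at \<open>m = 0\<close> to \<open>\<X>\<close> at
  \<open>m = n\<close>.\<close>

lemma vz_T_res_perp:
  assumes "W \<in> \<T>" shows "m \<le> n \<Longrightarrow> Y \<in> Pres X (n - m) \<X> \<P> \<Longrightarrow> vz m W Y"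
proof (induction m arbitrary: Y)
  case 0
  hence "Y \<in> \<P>" using Pres_P_subset by auto
  thus ?case using right_perp_vz assms by blast
next
  case (Suc m)
  have "Y \<in> \<X>" using Pres_res_perp[of \<P> \<X>] Suc.prems(2) by blast
  then obtain E D where E: "E \<in> \<P>" "tri Y E D" using res_perp_envelope by blast
  have "n - m = Suc (n - Suc m)" using Suc.prems(1) by simp
  hence "D \<in> Pres X (n - m) \<X> \<P>" using Pres_SucI[OF E(2,1) Suc.prems(2)] by simp
  hence "vz m W D" using Suc by simp
  thus ?case using vz_cocone[OF _ E(2)] right_perp_vz[OF _ assms] E(1) assms T_Ob by blast
qed

lemma T_res_le: "\<T> \<subseteq> res_le X \<C> n"
proof
  fix W assume W: "W \<in> \<T>"
  show "W \<in> res_le X \<C> n"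
  proof (rule res_perp_res_le)
    show "W \<in> \<X>" using W T_sub_P by blast
    show "vz n W Y" if "Y \<in> \<X>" for Y using vz_T_res_perp[OF W order_refl] that by (simp add: Pres_0)
  qed
qed

text \<open>The summand \<open>L\<close> of \<open>E\<close> lies in \<open>\<P>\<close> and is \<open>Ext\<close>-projective in \<open>\<P>\<close>, hence it is in \<open>\<T>\<close>.\<close>

lemma C_cores_finite: "\<C> \<subseteq> cores_finite X \<T>"
proof
  fix A assume A: "A \<in> \<C>"
  obtain Q F where Q: "Q \<in> \<P>" "F \<in> cores_finite X \<T>" "tri A Q F" using C_envelope[OF A] by blast
  obtain L W where L: "L \<in> \<P>" "W \<in> \<T>" "tri L W Q" using P_cover[OF Q(1)] by blast
  \<comment> \<open>\<open>E\<close> is the pullback of the cover \<open>W -> Q\<close> along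
    \<open>A -> Q\<close>; as extensions of \<open>A\<close> by \<open>L\<close> vanish, it is the
    direct sum of \<open>L\<close> and \<open>A\<close>.\<close>
  obtain E where E: "tri E W F" "tri L E A" using deflation_comp[OF Q(3) L(3)] by blast
  have AL: "van A L" using right_perp_van[OF res_perp_perp A] L(1) by blast
  obtain L' W' where L': "L' \<in> \<P>" "W' \<in> \<T>" "tri L' W' L" using P_cover[OF L(1)] by blast
  have "van E L'"
    using vz_left_cocone[OF E(1) right_perp_vz[OF _ L(2)] cores_finite_vz[OF Q(2)], of L' 0] L'(1)
    by (simp add: vz_0)
  hence "van L L'" using van_summand[OF van_split[OF E(2) AL]] by blast
  hence LT: "L \<in> \<T>" using subcategory_cone[OF subcategory_T L'(3)] L'(2) by blast
  \<comment> \<open>The summand inclusion \<open>A -> E\<close> followed by \<open>E -> W\<close>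
    embeds \<open>A\<close> in an object of \<open>\<T>\<close>, with cone an extension of
    \<open>F\<close> by \<open>L\<close>.\<close>
  obtain G where G: "tri A W G" "tri L G F"
    using inflation_comp[OF van_swap[OF E(2) AL] E(1)] by blast
  have "G \<in> cores_finite X \<T>"
    using cores_finite_ext[OF subcategory_T self_orthogonal_T G(2)] LT subset_cores_finite Q(2)
    by blast
  thus "A \<in> cores_finite X \<T>" using cores_finite_intro[OF G(1) L(2)] by blast
qed

lemma n_tilting_pair: "n_tilting_pair X n \<C> \<T>"
proof -
  have "res_dim X \<C> M \<le> n" if "M \<in> \<T>" for M
    unfolding res_dim_def using that T_res_le by (blast intro: Least_le)
  moreover have "\<T> \<subseteq> res_finite X \<C>" using T_res_le unfolding res_finite_def by blast
  ultimately show ?thesis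
    using subcategory_C subcategory_T self_orthogonal_C self_orthogonal_T C_cores_finite
    unfolding n_tilting_pair_def tilting_pair_def by blast
qed

end

theorem theorem4p9:
  fixes X :: "('o, 'm, 'e) extri_data"
    and \<C> \<T> :: "'o set"
    and n :: nat
  assumes "extriangulated_category X"
    and "krull_schmidt X"
    and "enough_projectives X"
    and "enough_injectives X"
    and "WIC X"
    and "subcategory X \<C>" and "self_orthogonal X \<C>"
    and "subcategory X \<T>"
    and "n \<ge> 1"
    and "\<C> \<subseteq> Copres X n (Pres X n (res_perp X \<C>) \<T>)"
    and "strongly_contravariantly_finite X \<T>"
  shows "n_tilting_pair X n \<C> \<T> \<longleftrightarrow>
         Pres X n (res_perp X \<C>) \<T> = right_perp X \<T> \<inter> res_perp X \<C>"
proof -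
  interpret self_orthogonal_subcategory X \<C>
    using assms(1,3,4,6,7)
    by (simp add: self_orthogonal_subcategory_def self_orthogonal_subcategory_axioms_def
        extriangulated_with_enough_def extriangulated_with_enough_axioms_def)
  show ?thesis
  proof
    show "Pres X n \<X> \<T> = right_perp X \<T> \<inter> \<X>" if "n_tilting_pair X n \<C> \<T>"
      using Pres_eq_of_n_tilting_pair[OF that assms(11)] .
    assume "Pres X n \<X> \<T> = right_perp X \<T> \<inter> \<X>"
    then interpret perp_presented X \<C> \<T> n
      using assms(8-11) by unfold_locales
    show "n_tilting_pair X n \<C> \<T>" by (rule n_tilting_pair)
  qed
qed

end
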